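(* Let $X$ be a connected, oriented, non-compact $C^\infty$ Riemannian manifold, $\mathcal D=C_0^\infty(X)$ (real-valued), $\mathcal D'$ its dual, and $\mathcal C_\sigma(\mathcal D')$ the cylinder $\sigma$-algebra on $\mathcal D'$. Let $\rho$ be a measure on $(\Gamma_{X,0},\mathcal B(\Gamma_{X,0}))$ such that: (1) $\rho(\Gamma_X^{(0)})=1$; (2) for every compact $\Lambda\subset X$ there is a constant $C_\Lambda>0$ such that $\rho(\Gamma_\Lambda^{(n)})\le C_\Lambda^n$ for all $n\in\mathbb N$; (3) $\int_{\Gamma_{X,0}}(G\star\overline G)(\eta)\,\rho(d\eta)\ge 0$ for every $G\in\mathcal F_{\rm fin}(\mathcal D)$. Let $\mu$ be the probability measure on $(\mathcal D',\mathcal C_\sigma(\mathcal D'))$ associated with $\rho$, namely the spectral measure for which the map $$\widehat{\mathcal F}_{\rm fin}(\mathcal D)\ni\widehat G\mapsto(K\widehat G)(\omega)=\sum_{n=0}^\infty\langle G^{(n)},{:}\omega^{\otimes n}{:}\rangle$$ ($G$ any representative of $\widehat G$) is well defined and extends by continuity to a unitary isomorphism $K:\mathcal H_\rho\to L^2(\mathcal D',\mathcal C_\sigma(\mathcal D'),d\mu)$ with $KA_\varphi^\sim K^{-1}=\langle\varphi,\cdot\rangle\,\cdot$ (multiplication operator) for all $\varphi\in\mathcal D$. Then for each $G\in\mathcal H_\rho$, $$\int_{\Gamma_{X,0}}G(\eta)\,\rho(d\eta)=\int_{\mathcal D'}(KG)(\omega)\,\mu(d\omega).$$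
   Context: **Function spaces.** $\mathcal D=C_0^\infty(X)$ carries its usual nuclear topology; $\mathcal D_{\mathbb C}$ is its complexification. $\mathcal F_0(\mathcal D)=\mathbb C$ and, for $n\ge1$, $\mathcal F_n(\mathcal D)=\mathcal D_{\mathbb C}^{\widehat\otimes n}$ ($\widehat\otimes$ = symmetric tensor product), i.e. the space of complex-valued symmetric $C^\infty$ functions on $X^n$ with compact support. $\mathcal F_{\rm fin}(\mathcal D)=\bigoplus_{n\ge0}\mathcal F_n(\mathcal D)$ is the topological direct sum, whose elements are finite sequences $G=(G^{(0)},\dots,G^{(n)},0,0,\dots)$. $G^{(n)}\in\mathcal F_n(\mathcal D)$ is identified with the sequence having $G^{(n)}$ at place $n$ and $0$ elsewhere; in particular $\varphi\in\mathcal D$ is an element of $\mathcal F_{\rm fin}(\mathcal D)$. Pairings $\langle\cdot,\cdot\rangle$ between (tensor powers of) $\mathcal D$ and $\mathcal D'$ are extended complex-bilinearly. **Configurations.** $\ddot\Gamma_{X,0}=\bigsqcup_{n\ge0}\ddot\Gamma_X^{(n)}$, where $\ddot\Gamma_X^{(0)}=\{\varnothing\}$ and $\ddot\Gamma_X^{(n)}=X^n/S_n$ with the quotient topology (disjoint-union topology on $\ddot\Gamma_{X,0}$); elements are written $[x_1,\dots,x_n]$. Each $G\in\mathcal F_{\rm fin}(\mathcal D)$ is a function on $\ddot\Gamma_{X,0}$ via $G(\varnothing)=G^{(0)}$, $G([x_1,\dots,x_n])=G^{(n)}(x_1,\dots,x_n)$. $\Gamma_{X,0}\subset\ddot\Gamma_{X,0}$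 (relative topology) consists of $\varnothing$ and all $[x_1,\dots,x_n]$ with pairwise distinct $x_i$, identified with finite subsets of $X$; $\Gamma_X^{(n)}$ is the set of $n$-point elements of $\Gamma_{X,0}$, and for $\Lambda\subset X$, $\Gamma_\Lambda^{(n)}$ is the set of $n$-point subsets of $\Lambda$. **Convolution.** For $G_1,G_2\in\mathcal F_{\rm fin}(\mathcal D)$, $$(G_1\star G_2)(\eta)=\sum_{(\xi_1,\xi_2,\xi_3)\in\mathcal P_3(\eta)}G_1(\xi_1\cup\xi_2)\,G_2(\xi_2\cup\xi_3),$$ where for $\eta=[x_1,\dots,x_n]$ the sum is over all ordered triples of pairwise disjoint, possibly empty, subsets of $\{1,\dots,n\}$ with union $\{1,\dots,n\}$, and an index set $\xi$ is identified with the class $[x_i]_{i\in\xi}$ (and $\varnothing$ with $\varnothing$). One has $G_1\star G_2\in\mathcal F_{\rm fin}(\mathcal D)$. **Hilbert space and operators.** $a_\rho(G_1,G_2)=\int_{\Gamma_{X,0}}(G_1\star G_2)(\eta)\,\rho(d\eta)$. $\widehat{\mathcal F}_{\rm fin}(\mathcal D)=\mathcal F_{\rm fin}(\mathcal D)/\{G':a_\rho(G',\overline{G'})=0\}$, with classes denoted $\widehat G$; $\mathcal H_\rho$ is the complex Hilbert space obtained by completing $\widehat{\mathcal F}_{\rm fin}(\mathcal D)$ in the scalar product $(\widehat G_1,\widehat G_2)_{\mathcal H_\rho}=a_\rho(G_1,\overline{G_2})$. For $\varphi\in\mathcal D$, $A_\varphi$ is the (well-defined) operator in $\mathcal H_\rho$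 with domain $\widehat{\mathcal F}_{\rm fin}(\mathcal D)$ given by $A_\varphi\widehat G=\widehat{\varphi\star G}$; under (1)–(3) it is essentially selfadjoint, and $A_\varphi^\sim$ denotes its closure. Under (1)–(3) a probability measure $\mu$ with the properties described in the claim exists. **Meaning of the left-hand integral.** For a general element $G$ of the completion $\mathcal H_\rho$, $\int_{\Gamma_{X,0}}G\,d\rho$ denotes the value at $G$ of the continuous extension to $\mathcal H_\rho$ of the functional $\widehat G\mapsto\int_{\Gamma_{X,0}}G(\eta)\,\rho(d\eta)$ on $\widehat{\mathcal F}_{\rm fin}(\mathcal D)$, i.e. $(G,\widehat\Omega)_{\mathcal H_\rho}$ with $\Omega=(1,0,0,\dots)$. **Wick powers.** For $\omega\in\mathcal D'$, ${:}\omega^{\otimes n}{:}\in\mathcal D'^{\widehat\otimes n}$ is defined by ${:}\omega^{\otimes 0}{:}=1$, ${:}\omega^{\otimes1}{:}=\omega$, and, for all $\varphi\in\mathcal D$, $$\langle\varphi^{\otimes(n+1)},{:}\omega^{\otimes(n+1)}{:}\rangle=\tfrac1{n+1}\big[\langle\varphi^{\otimes(n+1)},{:}\omega^{\otimes n}{:}\,\widehat\otimes\,\omega\rangle-n\langle(\varphi^2)\widehat\otimes\varphi^{\otimes(n-1)},{:}\omega^{\otimes n}{:}\rangle\big].$$ *)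

theory Defs
  imports
    "HOL-Probability.Probability"
    "HOL-Combinatorics.Permutations"
    "Jordan_Normal_Form.Determinant"
begin

section \<open>Smooth functions and smooth manifolds\<close>

text \<open>
  The model space of dimension \<open>d\<close> is the library topology \<^term>\<open>Euclidean_space d\<close> on the
  functions \<open>u :: nat \<Rightarrow> real\<close> with \<open>u i = 0\<close> for \<open>i \<ge> d\<close>. Its dimension is a term, not a type, so
  that all the powers of a manifold are available at once.
\<close>

definition partial_deriv :: "nat \<Rightarrow> ((nat \<Rightarrow> real) \<Rightarrow> real) \<Rightarrow> (nat \<Rightarrow> real) \<Rightarrow> real" where
  "partial_deriv i f u = deriv (\<lambda>t. f (u(i := t))) (u i)"

fun iter_partial :: "nat list \<Rightarrow> ((nat \<Rightarrow> real) \<Rightarrow> real) \<Rightarrow> (nat \<Rightarrow> real) \<Rightarrow> real" where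
  "iter_partial [] f = f"
| "iter_partial (i # is) f = partial_deriv i (iter_partial is f)"

text \<open>\<open>W\<close> is meant to be an open subset of \<^term>\<open>Euclidean_space d\<close>.\<close>

definition smooth_on :: "nat \<Rightarrow> (nat \<Rightarrow> real) set \<Rightarrow> ((nat \<Rightarrow> real) \<Rightarrow> real) \<Rightarrow> bool" where
  "smooth_on d W f \<longleftrightarrow>
     (\<forall>is. set is \<subseteq> {..<d} \<longrightarrow>
        continuous_map (subtopology (Euclidean_space d) W) euclideanreal (iter_partial is f) \<and>
        (\<forall>i<d. \<forall>u\<in>W. (\<lambda>t. iter_partial is f (u(i := t))) differentiable (at (u i))))"

type_synonym 'p chart = "'p set \<times> ('p \<Rightarrow> nat \<Rightarrow> real)"

text \<open>A chart \<open>(U, c)\<close> consists of its domain and its coordinate map; only \<open>c\<close> on \<open>U\<close> matters.\<close>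

record 'p manifold =
  mtop :: "'p topology"
  mdim :: nat
  charts :: "'p chart set"

definition smooth_manifold :: "'p manifold \<Rightarrow> bool" where
  "smooth_manifold M \<longleftrightarrow>
     Hausdorff_space (mtop M) \<and> second_countable (mtop M) \<and>
     topspace (mtop M) = (\<Union>(U, c)\<in>charts M. U) \<and>
     (\<forall>(U, c)\<in>charts M.
        openin (mtop M) U \<and> openin (Euclidean_space (mdim M)) (c ` U) \<and>
        homeomorphic_map (subtopology (mtop M) U)
          (subtopology (Euclidean_space (mdim M)) (c ` U)) c) \<and>
     (\<forall>(U, c)\<in>charts M. \<forall>(V, e)\<in>charts M. \<forall>j<mdim M.
        smooth_on (mdim M) (c ` (U \<inter> V)) (\<lambda>u. e (inv_into U c u) j))"

definition jacobian :: "nat \<Rightarrow> 'p chart \<Rightarrow> 'p chart \<Rightarrow> 'p \<Rightarrow> real mat" where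
  "jacobian d C E p =
     mat d d (\<lambda>(j, i). partial_deriv i (\<lambda>u. snd E (inv_into (fst C) (snd C) u) j) (snd C p))"

text \<open>
  An oriented manifold is given by an atlas of positively oriented charts.
\<close>

definition oriented :: "'p manifold \<Rightarrow> bool" where
  "oriented M \<longleftrightarrow>
     (\<forall>C\<in>charts M. \<forall>E\<in>charts M. \<forall>p\<in>fst C \<inter> fst E.
        Determinant.det (jacobian (mdim M) C E p) > 0)"

text \<open>
  A Riemannian metric, given by its coefficient matrix \<open>g C p\<close> at each point \<open>p\<close> of the domain of
  each chart \<open>C\<close>, subject to the transformation rule of a twofold covariant tensor.
\<close>

definition riemannian_metric :: "'p manifold \<Rightarrow> ('p chart \<Rightarrow> 'p \<Rightarrow> real mat) \<Rightarrow> bool" where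
  "riemannian_metric M g \<longleftrightarrow>
     (\<forall>C\<in>charts M. \<forall>p\<in>fst C.
        g C p \<in> carrier_mat (mdim M) (mdim M) \<and> transpose_mat (g C p) = g C p \<and>
        (\<forall>v\<in>carrier_vec (mdim M). v \<noteq> 0\<^sub>v (mdim M) \<longrightarrow>
           scalar_prod v (mult_mat_vec (g C p) v) > 0)) \<and>
     (\<forall>(U, c)\<in>charts M. \<forall>i<mdim M. \<forall>j<mdim M.
        smooth_on (mdim M) (c ` U) (\<lambda>u. g (U, c) (inv_into U c u) $$ (i, j))) \<and>
     (\<forall>C\<in>charts M. \<forall>E\<in>charts M. \<forall>p\<in>fst C \<inter> fst E.
        g C p = transpose_mat (jacobian (mdim M) C E p) * g E p * jacobian (mdim M) C E p)"

text \<open>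
  The power \<open>M\<^sup>n\<close>: its points are the extensional functions on \<open>{..<n}\<close>, and the coordinate of index
  \<open>i * mdim M + j\<close> is the \<open>j\<close>-th coordinate of the \<open>i\<close>-th point. For \<open>n = 0\<close> it is a single point.
\<close>

definition power_manifold :: "'p manifold \<Rightarrow> nat \<Rightarrow> (nat \<Rightarrow> 'p) manifold" where
  "power_manifold M n =
     \<lparr> mtop = product_topology (\<lambda>_. mtop M) {..<n},
       mdim = n * mdim M,
       charts = {(PiE {..<n} (\<lambda>i. fst (C i)),
                  \<lambda>x k. if k < n * mdim M
                        then snd (C (k div mdim M)) (x (k div mdim M)) (k mod mdim M) else 0) | C.
                  C \<in> {..<n} \<rightarrow> charts M} \<rparr>"


section \<open>Test functions and distributions\<close>

text \<open>Functions on \<open>M\<close> are set to \<open>0\<close> off the carrier of \<open>M\<close>, so that they form a set of functions.\<close>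

definition test_functions :: "'p manifold \<Rightarrow> ('p \<Rightarrow> real) set" where
  "test_functions M =
     {f. {p. f p \<noteq> 0} \<subseteq> topspace (mtop M) \<and>
         compactin (mtop M) (mtop M closure_of {p. f p \<noteq> 0}) \<and>
         (\<forall>(U, c)\<in>charts M. smooth_on (mdim M) (c ` U) (\<lambda>u. f (inv_into U c u)))}"

text \<open>
  The usual (LF) topology of the space of test functions: the finest locally convex topology that
  induces on each subspace of functions supported in a fixed compact set a topology coarser than or
  equal to the one of uniform convergence of all derivatives on compact subsets of chart domains.
  An entry \<open>(C, K, is)\<close> of the finite set \<open>S\<close> below stands for the seminorm
  \<open>sup\<^sub>K \<bar>\<partial>\<^sub>i\<^sub>s (f \<circ> C\<inverse>)\<bar>\<close>.
\<close>

definition zero_nbhd :: "'p manifold \<Rightarrow> ('p \<Rightarrow> real) set \<Rightarrow> bool" where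
  "zero_nbhd M V \<longleftrightarrow>
     V \<subseteq> test_functions M \<and>
     (\<forall>f\<in>V. \<forall>h\<in>V. \<forall>a b. \<bar>a\<bar> + \<bar>b\<bar> \<le> 1 \<longrightarrow> (\<lambda>p. a * f p + b * h p) \<in> V) \<and>
     (\<forall>L. compactin (mtop M) L \<longrightarrow>
        (\<exists>S. \<exists>\<epsilon>>0. finite S \<and>
           (\<forall>(C, K, is)\<in>S. C \<in> charts M \<and> compactin (mtop M) K \<and> K \<subseteq> fst C \<and>
              set is \<subseteq> {..<mdim M}) \<and>
           {f \<in> test_functions M. {p. f p \<noteq> 0} \<subseteq> L \<and>
              (\<forall>(C, K, is)\<in>S. \<forall>p\<in>K.
                 \<bar>iter_partial is (\<lambda>u. f (inv_into (fst C) (snd C) u)) (snd C p)\<bar> \<le> \<epsilon>)} \<subseteq> V))"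

definition test_open :: "'p manifold \<Rightarrow> ('p \<Rightarrow> real) set \<Rightarrow> bool" where
  "test_open M W \<longleftrightarrow>
     W \<subseteq> test_functions M \<and>
     (\<forall>f\<in>W. \<exists>V. zero_nbhd M V \<and> (\<forall>h\<in>V. (\<lambda>p. f p + h p) \<in> W))"

lemma zero_nbhd_Int:
  assumes "zero_nbhd M V" "zero_nbhd M V'"
  shows "zero_nbhd M (V \<inter> V')"
proof -
  have "\<exists>S. \<exists>\<epsilon>>0. finite S \<and>
           (\<forall>(C, K, is)\<in>S. C \<in> charts M \<and> compactin (mtop M) K \<and> K \<subseteq> fst C \<and>
              set is \<subseteq> {..<mdim M}) \<and>
           {f \<in> test_functions M. {p. f p \<noteq> 0} \<subseteq> L \<and>
              (\<forall>(C, K, is)\<in>S. \<forall>p\<in>K.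
                 \<bar>iter_partial is (\<lambda>u. f (inv_into (fst C) (snd C) u)) (snd C p)\<bar> \<le> \<epsilon>)} \<subseteq> V \<inter> V'"
    if L: "compactin (mtop M) L" for L
  proof -
    obtain S \<epsilon> where S: "\<epsilon> > 0" "finite S"
      "\<forall>(C, K, is)\<in>S. C \<in> charts M \<and> compactin (mtop M) K \<and> K \<subseteq> fst C \<and> set is \<subseteq> {..<mdim M}"
      "{f \<in> test_functions M. {p. f p \<noteq> 0} \<subseteq> L \<and>
          (\<forall>(C, K, is)\<in>S. \<forall>p\<in>K.
             \<bar>iter_partial is (\<lambda>u. f (inv_into (fst C) (snd C) u)) (snd C p)\<bar> \<le> \<epsilon>)} \<subseteq> V"
      using assms(1) L unfolding zero_nbhd_def by meson
    obtain S' \<epsilon>' where S': "\<epsilon>' > 0" "finite S'"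
      "\<forall>(C, K, is)\<in>S'. C \<in> charts M \<and> compactin (mtop M) K \<and> K \<subseteq> fst C \<and> set is \<subseteq> {..<mdim M}"
      "{f \<in> test_functions M. {p. f p \<noteq> 0} \<subseteq> L \<and>
          (\<forall>(C, K, is)\<in>S'. \<forall>p\<in>K.
             \<bar>iter_partial is (\<lambda>u. f (inv_into (fst C) (snd C) u)) (snd C p)\<bar> \<le> \<epsilon>')} \<subseteq> V'"
      using assms(2) L unfolding zero_nbhd_def by meson
    have "{f \<in> test_functions M. {p. f p \<noteq> 0} \<subseteq> L \<and>
              (\<forall>(C, K, is)\<in>S \<union> S'. \<forall>p\<in>K.
                 \<bar>iter_partial is (\<lambda>u. f (inv_into (fst C) (snd C) u)) (snd C p)\<bar> \<le> min \<epsilon> \<epsilon>')}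
          \<subseteq> V \<inter> V'"
      by (intro Int_greatest; rule subset_trans[OF _ S(4)] subset_trans[OF _ S'(4)]) fastforce+
    then show ?thesis
      using S(1-3) S'(1-3) by (intro exI[of _ "S \<union> S'"] exI[of _ "min \<epsilon> \<epsilon>'"]) auto
  qed
  then show ?thesis
    using assms unfolding zero_nbhd_def by (intro conjI) blast+
qed

lemma istopology_test_open: "istopology (test_open M)"
  unfolding istopology_def
proof (intro conjI allI impI)
  fix W W' assume W: "test_open M W" "test_open M W'"
  show "test_open M (W \<inter> W')"
    unfolding test_open_def
  proof (intro conjI ballI)
    show "W \<inter> W' \<subseteq> test_functions M"
      using W by (auto simp: test_open_def)
    fix f assume "f \<in> W \<inter> W'"
    then obtain V V' where "zero_nbhd M V" "\<forall>h\<in>V. (\<lambda>p. f p + h p) \<in> W"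
      "zero_nbhd M V'" "\<forall>h\<in>V'. (\<lambda>p. f p + h p) \<in> W'"
      using W unfolding test_open_def by blast
    then show "\<exists>V. zero_nbhd M V \<and> (\<forall>h\<in>V. (\<lambda>p. f p + h p) \<in> W \<inter> W')"
      by (intro exI[of _ "V \<inter> V'"]) (auto intro: zero_nbhd_Int)
  qed
next
  fix \<W> assume "\<forall>W\<in>\<W>. test_open M W"
  then show "test_open M (\<Union>\<W>)"
    unfolding test_open_def by (meson Sup_least UnionE UnionI)
qed

definition test_topology :: "'p manifold \<Rightarrow> ('p \<Rightarrow> real) topology" where
  "test_topology M = topology (test_open M)"

text \<open>
  The topological dual of a subspace \<open>V\<close> of the space of test functions; functionals are set to \<open>0\<close>
  off \<open>V\<close>.
\<close>

definition dual_space :: "'p manifold \<Rightarrow> ('p \<Rightarrow> real) set \<Rightarrow> (('p \<Rightarrow> real) \<Rightarrow> real) set" where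
  "dual_space M V =
     {T. (\<forall>f\<in>V. \<forall>h\<in>V. T (\<lambda>p. f p + h p) = T f + T h) \<and>
         (\<forall>f\<in>V. \<forall>a. T (\<lambda>p. a * f p) = a * T f) \<and>
         continuous_map (subtopology (test_topology M) V) euclideanreal T \<and>
         (\<forall>f. f \<notin> V \<longrightarrow> T f = 0)}"

definition distributions :: "'p manifold \<Rightarrow> (('p \<Rightarrow> real) \<Rightarrow> real) set" where
  "distributions M = dual_space M (test_functions M)"

definition cylinder_algebra :: "'p manifold \<Rightarrow> (('p \<Rightarrow> real) \<Rightarrow> real) measure" where
  "cylinder_algebra M =
     sigma (distributions M)
       {{\<omega> \<in> distributions M. \<omega> \<phi> \<in> B} | \<phi> B. \<phi> \<in> test_functions M \<and> B \<in> sets borel}"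

text \<open>Real symmetric test functions on \<open>X\<^sup>n\<close>, i.e. the \<open>n\<close>-th symmetric tensor power of the test functions.\<close>

definition sym_test_functions :: "'p manifold \<Rightarrow> nat \<Rightarrow> ((nat \<Rightarrow> 'p) \<Rightarrow> real) set" where
  "sym_test_functions X n =
     {f \<in> test_functions (power_manifold X n).
        \<forall>\<pi>. \<pi> permutes {..<n} \<longrightarrow>
          (\<forall>x\<in>topspace (mtop (power_manifold X n)). f (x \<circ> \<pi>) = f x)}"

definition sym_distributions :: "'p manifold \<Rightarrow> nat \<Rightarrow> (((nat \<Rightarrow> 'p) \<Rightarrow> real) \<Rightarrow> real) set" where
  "sym_distributions X n = dual_space (power_manifold X n) (sym_test_functions X n)"

text \<open>The symmetrization of \<open>\<psi>\<^sub>0 \<otimes> \<dots> \<otimes> \<psi>\<^sub>n\<^sub>-\<^sub>1\<close>.\<close>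

definition sym_tensor :: "'p manifold \<Rightarrow> nat \<Rightarrow> (nat \<Rightarrow> 'p \<Rightarrow> real) \<Rightarrow> (nat \<Rightarrow> 'p) \<Rightarrow> real" where
  "sym_tensor X n \<psi> x =
     (if x \<in> topspace (mtop (power_manifold X n))
      then (\<Sum>\<pi> | \<pi> permutes {..<n}. \<Prod>i<n. \<psi> i (x (\<pi> i))) / fact n else 0)"

abbreviation tensor_power :: "'p manifold \<Rightarrow> nat \<Rightarrow> ('p \<Rightarrow> real) \<Rightarrow> (nat \<Rightarrow> 'p) \<Rightarrow> real" where
  "tensor_power X n \<phi> \<equiv> sym_tensor X n (\<lambda>_. \<phi>)"

text \<open>
  Wick powers of a distribution. The value of \<open>wick X \<omega> n \<otimes> \<omega>\<close> (symmetrized or not) at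
  \<open>\<phi>\<^sup>\<otimes>\<^sup>(\<^sup>n\<^sup>+\<^sup>1\<^sup>)\<close> is \<open>wick X \<omega> n (\<phi>\<^sup>\<otimes>\<^sup>n) * \<omega> \<phi>\<close>. For \<open>n = 0\<close> the second term has the factor \<open>0\<close>, so the
  recursion then gives \<open>\<omega>\<close>.
\<close>

primrec wick :: "'p manifold \<Rightarrow> (('p \<Rightarrow> real) \<Rightarrow> real) \<Rightarrow> nat \<Rightarrow> ((nat \<Rightarrow> 'p) \<Rightarrow> real) \<Rightarrow> real" where
  "wick X \<omega> 0 = (\<lambda>f. f (\<lambda>_. undefined))"
| "wick X \<omega> (Suc n) =
     (THE T. T \<in> sym_distributions X (Suc n) \<and>
        (\<forall>\<phi>\<in>test_functions X.
           T (tensor_power X (Suc n) \<phi>) =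
             (wick X \<omega> n (tensor_power X n \<phi>) * \<omega> \<phi>
              - real n * wick X \<omega> n (sym_tensor X n ((\<lambda>_. \<phi>)(0 := \<lambda>p. (\<phi> p)\<^sup>2))))
             / real (n + 1)))"


section \<open>Finite configurations\<close>

text \<open>
  Classes \<open>[x\<^sub>1, \<dots>, x\<^sub>n]\<close> in \<open>X\<^sup>n / S\<^sub>n\<close> are multisets of size \<open>n\<close>; finite subsets of \<open>X\<close> are the
  multisets without repetitions.
\<close>

definition config :: "(nat \<Rightarrow> 'p) \<Rightarrow> nat set \<Rightarrow> 'p multiset" where
  "config x I = image_mset x (mset_set I)"

definition config_open :: "'p manifold \<Rightarrow> 'p multiset set \<Rightarrow> bool" where
  "config_open X W \<longleftrightarrow>
     W \<subseteq> {\<eta>. set_mset \<eta> \<subseteq> topspace (mtop X)} \<and>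
     (\<forall>n. openin (mtop (power_manifold X n))
        {x \<in> topspace (mtop (power_manifold X n)). config x {..<n} \<in> W})"

lemma istopology_config_open: "istopology (config_open X)"
  unfolding istopology_def
proof (intro conjI allI impI)
  fix W W' assume W: "config_open X W" "config_open X W'"
  have "{x \<in> A. config x {..<n} \<in> W \<inter> W'} =
      {x \<in> A. config x {..<n} \<in> W} \<inter> {x \<in> A. config x {..<n} \<in> W'}" for n and A :: "(nat \<Rightarrow> 'a) set"
    by blast
  then show "config_open X (W \<inter> W')"
    using W unfolding config_open_def by auto
next
  fix \<W> assume W: "\<forall>W\<in>\<W>. config_open X W"
  show "config_open X (\<Union>\<W>)"
    unfolding config_open_def
  proof (intro conjI allI)
    show "\<Union>\<W> \<subseteq> {\<eta>. set_mset \<eta> \<subseteq> topspace (mtop X)}"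
      using W unfolding config_open_def by (meson Sup_least)
    fix n
    let ?P = "\<lambda>W. {x \<in> topspace (mtop (power_manifold X n)). config x {..<n} \<in> W}"
    have "openin (mtop (power_manifold X n)) (\<Union>(?P ` \<W>))"
      using W unfolding config_open_def by (intro openin_Union) auto
    moreover have "\<Union>(?P ` \<W>) = ?P (\<Union>\<W>)"
      by auto
    ultimately show "openin (mtop (power_manifold X n)) (?P (\<Union>\<W>))"
      by simp
  qed
qed

text \<open>The disjoint union of the quotient topologies of the \<open>X\<^sup>n / S\<^sub>n\<close>.\<close>

definition config_topology :: "'p manifold \<Rightarrow> 'p multiset topology" where
  "config_topology X = topology (config_open X)"

definition simple_configs :: "'p manifold \<Rightarrow> 'p multiset set" where
  "simple_configs X = {\<eta>. set_mset \<eta> \<subseteq> topspace (mtop X) \<and> (\<forall>p. count \<eta> p \<le> 1)}"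

definition simple_config_borel :: "'p manifold \<Rightarrow> 'p multiset measure" where
  "simple_config_borel X =
     sigma (simple_configs X) {W. openin (subtopology (config_topology X) (simple_configs X)) W}"

definition n_point_configs :: "'p manifold \<Rightarrow> 'p set \<Rightarrow> nat \<Rightarrow> 'p multiset set" where
  "n_point_configs X \<Lambda> n = {\<eta> \<in> simple_configs X. set_mset \<eta> \<subseteq> \<Lambda> \<and> size \<eta> = n}"

text \<open>
  A finite sequence of symmetric functions \<open>G\<^sup>(\<^sup>n\<^sup>)\<close> on \<open>X\<^sup>n\<close> is represented by the corresponding function
  \<open>G\<close> on the multisets of points of \<open>X\<close>. The component functions are recovered as follows; their
  symmetry is automatic.
\<close>

definition component :: "'p manifold \<Rightarrow> ('p multiset \<Rightarrow> complex) \<Rightarrow> nat \<Rightarrow> (nat \<Rightarrow> 'p) \<Rightarrow> complex" where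
  "component X G n x =
     (if x \<in> topspace (mtop (power_manifold X n)) then G (config x {..<n}) else 0)"

definition F_fin :: "'p manifold \<Rightarrow> ('p multiset \<Rightarrow> complex) set" where
  "F_fin X =
     {G. (\<forall>\<eta>. \<not> set_mset \<eta> \<subseteq> topspace (mtop X) \<longrightarrow> G \<eta> = 0) \<and>
         (\<exists>N. \<forall>\<eta>. size \<eta> > N \<longrightarrow> G \<eta> = 0) \<and>
         (\<forall>n. (\<lambda>x. Re (component X G n x)) \<in> test_functions (power_manifold X n) \<and>
              (\<lambda>x. Im (component X G n x)) \<in> test_functions (power_manifold X n))}"

text \<open>A test function \<open>\<phi>\<close> as an element of \<^term>\<open>F_fin X\<close>.\<close>

definition one_particle :: "('p \<Rightarrow> real) \<Rightarrow> 'p multiset \<Rightarrow> complex" where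
  "one_particle \<phi> \<eta> = (if size \<eta> = 1 then complex_of_real (\<phi> (the_elem (set_mset \<eta>))) else 0)"

definition conj_fun :: "('p multiset \<Rightarrow> complex) \<Rightarrow> 'p multiset \<Rightarrow> complex" where
  "conj_fun G \<eta> = cnj (G \<eta>)"

definition star :: "('p multiset \<Rightarrow> complex) \<Rightarrow> ('p multiset \<Rightarrow> complex) \<Rightarrow> 'p multiset \<Rightarrow> complex"
    (infixl \<open>\<star>\<close> 70) where
  "(G\<^sub>1 \<star> G\<^sub>2) \<eta> =
     (let n = size \<eta>; x = (SOME x. config x {..<n} = \<eta>)
      in \<Sum>(I\<^sub>1, I\<^sub>2, I\<^sub>3) \<in> {(I\<^sub>1, I\<^sub>2, I\<^sub>3). I\<^sub>1 \<union> I\<^sub>2 \<union> I\<^sub>3 = {..<n} \<and>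
             I\<^sub>1 \<inter> I\<^sub>2 = {} \<and> I\<^sub>1 \<inter> I\<^sub>3 = {} \<and> I\<^sub>2 \<inter> I\<^sub>3 = {}}.
           G\<^sub>1 (config x (I\<^sub>1 \<union> I\<^sub>2)) * G\<^sub>2 (config x (I\<^sub>2 \<union> I\<^sub>3)))"


section \<open>The Hilbert space and its operators\<close>

definition rho_form ::
    "'p multiset measure \<Rightarrow> ('p multiset \<Rightarrow> complex) \<Rightarrow> ('p multiset \<Rightarrow> complex) \<Rightarrow> complex" where
  "rho_form \<rho> G\<^sub>1 G\<^sub>2 = (\<integral>\<eta>. (G\<^sub>1 \<star> G\<^sub>2) \<eta> \<partial>\<rho>)"

definition rho_seminorm :: "'p multiset measure \<Rightarrow> ('p multiset \<Rightarrow> complex) \<Rightarrow> real" where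
  "rho_seminorm \<rho> G = sqrt (Re (rho_form \<rho> G (conj_fun G)))"

text \<open>
  The completion is built from Cauchy sequences in \<^term>\<open>F_fin X\<close> for the seminorm above, modulo
  sequences tending to \<open>0\<close>. The quotient of \<^term>\<open>F_fin X\<close> by the null space of the form sits in it as
  the set of the classes of constant sequences.
\<close>

definition cauchy_seqs :: "'p manifold \<Rightarrow> 'p multiset measure \<Rightarrow> (nat \<Rightarrow> 'p multiset \<Rightarrow> complex) set" where
  "cauchy_seqs X \<rho> =
     {S. (\<forall>k. S k \<in> F_fin X) \<and>
         (\<forall>\<epsilon>>0. \<exists>N. \<forall>k\<ge>N. \<forall>l\<ge>N. rho_seminorm \<rho> (\<lambda>\<eta>. S k \<eta> - S l \<eta>) < \<epsilon>)}"

definition null_rel ::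
    "'p manifold \<Rightarrow> 'p multiset measure \<Rightarrow>
     ((nat \<Rightarrow> 'p multiset \<Rightarrow> complex) \<times> (nat \<Rightarrow> 'p multiset \<Rightarrow> complex)) set" where
  "null_rel X \<rho> =
     {(S, T). S \<in> cauchy_seqs X \<rho> \<and> T \<in> cauchy_seqs X \<rho> \<and>
        (\<lambda>k. rho_seminorm \<rho> (\<lambda>\<eta>. S k \<eta> - T k \<eta>)) \<longlonglongrightarrow> 0}"

definition H_space ::
    "'p manifold \<Rightarrow> 'p multiset measure \<Rightarrow> (nat \<Rightarrow> 'p multiset \<Rightarrow> complex) set set" where
  "H_space X \<rho> = cauchy_seqs X \<rho> // null_rel X \<rho>"

definition H_class ::
    "'p manifold \<Rightarrow> 'p multiset measure \<Rightarrow> (nat \<Rightarrow> 'p multiset \<Rightarrow> complex) \<Rightarrow>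
     (nat \<Rightarrow> 'p multiset \<Rightarrow> complex) set" where
  "H_class X \<rho> S = null_rel X \<rho> `` {S}"

definition hat ::
    "'p manifold \<Rightarrow> 'p multiset measure \<Rightarrow> ('p multiset \<Rightarrow> complex) \<Rightarrow>
     (nat \<Rightarrow> 'p multiset \<Rightarrow> complex) set" where
  "hat X \<rho> G = H_class X \<rho> (\<lambda>_. G)"

definition H_inner ::
    "'p multiset measure \<Rightarrow> (nat \<Rightarrow> 'p multiset \<Rightarrow> complex) set \<Rightarrow>
     (nat \<Rightarrow> 'p multiset \<Rightarrow> complex) set \<Rightarrow> complex" where
  "H_inner \<rho> \<xi> \<zeta> =
     (THE z. \<forall>S\<in>\<xi>. \<forall>T\<in>\<zeta>. (\<lambda>k. rho_form \<rho> (S k) (conj_fun (T k))) \<longlonglongrightarrow> z)"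

text \<open>
  In the completion, \<open>hat X \<rho> (S k)\<close> tends to \<open>\<xi>\<close> if and only if the sequence \<open>S\<close> is a member of the
  class \<open>\<xi>\<close>. Hence the next two definitions are the continuous extension of the integral from
  \<^term>\<open>F_fin X\<close> and the graph of the closure of the operator \<open>hat X \<rho> G \<mapsto> hat X \<rho> (one_particle \<phi> \<star> G)\<close>.
\<close>

definition H_integral ::
    "'p multiset measure \<Rightarrow> (nat \<Rightarrow> 'p multiset \<Rightarrow> complex) set \<Rightarrow> complex" where
  "H_integral \<rho> \<xi> = (THE z. \<forall>S\<in>\<xi>. (\<lambda>k. \<integral>\<eta>. S k \<eta> \<partial>\<rho>) \<longlonglongrightarrow> z)"

definition A_closure ::
    "'p manifold \<Rightarrow> 'p multiset measure \<Rightarrow> ('p \<Rightarrow> real) \<Rightarrow>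
     ((nat \<Rightarrow> 'p multiset \<Rightarrow> complex) set \<times> (nat \<Rightarrow> 'p multiset \<Rightarrow> complex) set) set" where
  "A_closure X \<rho> \<phi> =
     {(\<xi>, \<zeta>). \<xi> \<in> H_space X \<rho> \<and> \<zeta> \<in> H_space X \<rho> \<and>
        (\<exists>S\<in>\<xi>. (\<lambda>k. one_particle \<phi> \<star> S k) \<in> \<zeta>)}"


section \<open>The spectral measure\<close>

definition square_integrable :: "'w measure \<Rightarrow> ('w \<Rightarrow> complex) \<Rightarrow> bool" where
  "square_integrable \<mu> f \<longleftrightarrow> f \<in> borel_measurable \<mu> \<and> integrable \<mu> (\<lambda>\<omega>. (cmod (f \<omega>))\<^sup>2)"

text \<open>The pairing of \<open>G\<^sup>(\<^sup>n\<^sup>)\<close> with the \<open>n\<close>-th Wick power, extended complex-linearly.\<close>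

definition wick_pairing ::
    "'p manifold \<Rightarrow> ('p multiset \<Rightarrow> complex) \<Rightarrow> nat \<Rightarrow> (('p \<Rightarrow> real) \<Rightarrow> real) \<Rightarrow> complex" where
  "wick_pairing X G n \<omega> =
     Complex (wick X \<omega> n (\<lambda>x. Re (component X G n x))) (wick X \<omega> n (\<lambda>x. Im (component X G n x)))"

text \<open>
  \<open>K\<close> assigns to every element of the Hilbert space a representative of an element of \<open>L\<^sup>2(\<mu>)\<close>;
  statements about \<open>K \<xi>\<close> are accordingly made up to \<open>\<mu>\<close>-null sets.
\<close>

definition unitary_onto_L2 ::
    "'p manifold \<Rightarrow> 'p multiset measure \<Rightarrow> 'w measure \<Rightarrow>
     ((nat \<Rightarrow> 'p multiset \<Rightarrow> complex) set \<Rightarrow> 'w \<Rightarrow> complex) \<Rightarrow> bool" where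
  "unitary_onto_L2 X \<rho> \<mu> K \<longleftrightarrow>
     (\<forall>\<xi>\<in>H_space X \<rho>. square_integrable \<mu> (K \<xi>)) \<and>
     (\<forall>S\<in>cauchy_seqs X \<rho>. \<forall>T\<in>cauchy_seqs X \<rho>. \<forall>a b. AE \<omega> in \<mu>.
        K (H_class X \<rho> (\<lambda>k \<eta>. a * S k \<eta> + b * T k \<eta>)) \<omega> =
          a * K (H_class X \<rho> S) \<omega> + b * K (H_class X \<rho> T) \<omega>) \<and>
     (\<forall>\<xi>\<in>H_space X \<rho>. \<forall>\<zeta>\<in>H_space X \<rho>. (\<integral>\<omega>. K \<xi> \<omega> * cnj (K \<zeta> \<omega>) \<partial>\<mu>) = H_inner \<rho> \<xi> \<zeta>) \<and>
     (\<forall>f. square_integrable \<mu> f \<longrightarrow> (\<exists>\<xi>\<in>H_space X \<rho>. AE \<omega> in \<mu>. K \<xi> \<omega> = f \<omega>))"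

text \<open>
  The last clause says that \<open>K\<close> carries the closure of the operator associated with \<open>\<phi>\<close>, domain
  included, to the maximal operator of multiplication by \<open>\<omega> \<mapsto> \<omega> \<phi>\<close>.
\<close>

definition is_spectral_measure ::
    "'p manifold \<Rightarrow> 'p multiset measure \<Rightarrow> (('p \<Rightarrow> real) \<Rightarrow> real) measure \<Rightarrow>
     ((nat \<Rightarrow> 'p multiset \<Rightarrow> complex) set \<Rightarrow> (('p \<Rightarrow> real) \<Rightarrow> real) \<Rightarrow> complex) \<Rightarrow> bool" where
  "is_spectral_measure X \<rho> \<mu> K \<longleftrightarrow>
     prob_space \<mu> \<and> sets \<mu> = sets (cylinder_algebra X) \<and>
     (\<forall>G\<in>F_fin X. AE \<omega> in \<mu>. K (hat X \<rho> G) \<omega> = (\<Sum>n. wick_pairing X G n \<omega>)) \<and>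
     unitary_onto_L2 X \<rho> \<mu> K \<and>
     (\<forall>\<phi>\<in>test_functions X. \<forall>\<xi>\<in>H_space X \<rho>. \<forall>\<zeta>\<in>H_space X \<rho>.
        (\<xi>, \<zeta>) \<in> A_closure X \<rho> \<phi> \<longleftrightarrow>
          square_integrable \<mu> (\<lambda>\<omega>. complex_of_real (\<omega> \<phi>) * K \<xi> \<omega>) \<and>
          (AE \<omega> in \<mu>. K \<zeta> \<omega> = complex_of_real (\<omega> \<phi>) * K \<xi> \<omega>))"

end

(*
  Let Omega be the vacuum (1, 0, 0, ...). Since G * Omega = G, the integral of G is the scalar
  product of G with Omega, so by unitarity of K the claim reduces to K Omega = 1 almost everywhere.

  The existence of the Wick powers is not needed for this. Linearity of K makes the series defining
  K at the zero class vanish almost everywhere. At a point where this series converges, the series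
  for Omega differs from it by the term 1 at n = 0, so that K Omega = 1 there. At a point where it
  diverges, the series of every finite sequence G diverges too, and all their formal sums agree
  with the one of the zero class, so K G = 0 there. Hence 1 - K Omega is orthogonal to the
  image of all finite sequences, which is dense, and vanishes.
*)
theory Submission
  imports Defs
begin

section \<open>Test functions on a manifold\<close>

text \<open>The scalar product and the integral on the completion are given by \<open>THE\<close>,
  as limits common to all representatives, and the Bochner integral of a non-integrable function is
  0. So neither the sesquilinearity of the form nor the existence of these limits is automatic; both
  rest on the integrability of every convolution \<open>G \<star> conj_fun H\<close>. The
  topological work serves this fact: test functions on powers of the manifold are continuous, so a
  convolution is a continuous and bounded function of configurations, it vanishes unless the points
  are boundedly many and lie in one compact set, and condition (2) gives such configurations finite
  measure. Density of the finite sequences is used on representatives as well: a Cauchy sequence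
  that is weakly null against each fixed finite sequence is null in the seminorm.\<close>

lemma continuous_map_fun_upd_Euclidean_space:
  assumes "u \<in> topspace (Euclidean_space d)" "i < d"
  shows "continuous_map euclideanreal (Euclidean_space d) (\<lambda>t. u(i := t))"
proof -
  have "continuous_map euclideanreal euclideanreal (\<lambda>t. (u(i := t)) j)" for j
    by (cases "j = i") auto
  then have "continuous_map euclideanreal (Euclidean_space d) (\<lambda>t j. if j < d then (u(i := t)) j else 0)"
    by (simp only: continuous_map_componentwise_Euclidean_space) simp
  \<comment> \<open>The truncation changes nothing, because \<open>u\<close> vanishes from index
    \<open>d\<close> on and \<open>i < d\<close>.\<close>
  moreover have "(\<lambda>t j. if j < d then (u(i := t)) j else 0) = (\<lambda>t. u(i := t))"
    using assms by (auto simp: topspace_Euclidean_space fun_eq_iff)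
  ultimately show ?thesis by simp
qed

text \<open>A partial derivative at \<open>u\<close> sees a function only along a coordinate line
  near \<open>u\<close>. Openness of \<open>W\<close> turns an identity on \<open>W\<close> into one
  valid near \<open>u i\<close> on that line, as \<open>deriv_cong_ev\<close> requires.\<close>

lemma eventually_fun_upd_in_open:
  assumes W: "openin (Euclidean_space d) W" and u: "u \<in> W" and i: "i < d"
  shows "eventually (\<lambda>t. u(i := t) \<in> W) (nhds (u i))"
proof -
  have "u \<in> topspace (Euclidean_space d)"
    using W u openin_subset by blast
  then have "openin euclideanreal {t \<in> topspace euclideanreal. u(i := t) \<in> W}"
    by (intro openin_continuous_map_preimage[OF continuous_map_fun_upd_Euclidean_space W] i)
  then have "open {t. u(i := t) \<in> W}"
    by simp
  then show ?thesis
    using u by (auto simp: eventually_nhds intro!: exI[of _ "{t. u(i := t) \<in> W}"])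
qed

text \<open>Linearity of \<open>deriv\<close> requires differentiability, which
  \<open>smooth_on\<close> grants at points of \<open>W\<close>. Hence the identity is proved on
  \<open>W\<close>, with \<open>u\<close> arbitrary in the induction so that it can be used along a
  whole piece of a coordinate line.\<close>

lemma iter_partial_lincomb:
  assumes W: "openin (Euclidean_space d) W" and f: "smooth_on d W f" and h: "smooth_on d W h"
    and "set is \<subseteq> {..<d}" and "u \<in> W"
  shows "iter_partial is (\<lambda>u. a * f u + b * h u) u = a * iter_partial is f u + b * iter_partial is h u"
  using assms(4,5)
proof (induction "is" arbitrary: u)
  case (Cons i js)
  let ?F = "\<lambda>t. iter_partial js f (u(i := t))" and ?H = "\<lambda>t. iter_partial js h (u(i := t))"
  have i: "i < d" and js: "set js \<subseteq> {..<d}"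
    using Cons.prems by auto
  have "eventually (\<lambda>t. iter_partial js (\<lambda>u. a * f u + b * h u) (u(i := t)) = a * ?F t + b * ?H t) (nhds (u i))"
    using eventually_fun_upd_in_open[OF W Cons.prems(2) i]
    by eventually_elim (rule Cons.IH[OF js])
  then have "partial_deriv i (iter_partial js (\<lambda>u. a * f u + b * h u)) u
      = deriv (\<lambda>t. a * ?F t + b * ?H t) (u i)"
    unfolding partial_deriv_def by (rule deriv_cong_ev) simp
  also have "\<dots> = a * deriv ?F (u i) + b * deriv ?H (u i)"
  proof -
    have "(?F has_field_derivative deriv ?F (u i)) (at (u i))"
      "(?H has_field_derivative deriv ?H (u i)) (at (u i))"
      using f h js i Cons.prems(2)
      by (auto simp: smooth_on_def DERIV_deriv_iff_real_differentiable)
    then show ?thesis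
      by (intro DERIV_imp_deriv) (auto intro!: derivative_eq_intros)
  qed
  finally show ?case
    by (simp add: partial_deriv_def)
qed simp

lemma smooth_on_lincomb:
  assumes W: "openin (Euclidean_space d) W" and f: "smooth_on d W f" and h: "smooth_on d W h"
  shows "smooth_on d W (\<lambda>u. a * f u + b * h u)"
  unfolding smooth_on_def
proof (intro allI impI conjI ballI)
  fix js assume js: "set js \<subseteq> {..<d}"
  note eq = iter_partial_lincomb[OF W f h js]
  have "continuous_map (subtopology (Euclidean_space d) W) euclideanreal
      (\<lambda>u. a * iter_partial js f u + b * iter_partial js h u)"
    using f h js unfolding smooth_on_def
    by (intro continuous_map_add continuous_map_real_mult continuous_map_const[THEN iffD2]) auto
  then show "continuous_map (subtopology (Euclidean_space d) W) euclideanreal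
      (iter_partial js (\<lambda>u. a * f u + b * h u))"
    by (rule continuous_map_eq) (auto simp: eq)
  fix i u assume i: "i < d" and u: "u \<in> W"
  let ?F = "\<lambda>t. iter_partial js f (u(i := t))" and ?H = "\<lambda>t. iter_partial js h (u(i := t))"
  have "?F differentiable at (u i)" "?H differentiable at (u i)"
    using f h js i u by (auto simp: smooth_on_def)
  then have "(\<lambda>t. a * ?F t + b * ?H t) differentiable at (u i)"
    by (intro derivative_intros)
  moreover have "eventually (\<lambda>t. iter_partial js (\<lambda>u. a * f u + b * h u) (u(i := t)) = a * ?F t + b * ?H t)
      (nhds (u i))"
    using eventually_fun_upd_in_open[OF W u i] by eventually_elim (rule eq)
  ultimately show "(\<lambda>t. iter_partial js (\<lambda>u. a * f u + b * h u) (u(i := t))) differentiable at (u i)"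
    by (auto simp: real_differentiable_def cong: DERIV_cong_ev)
qed

lemma compactin_closure_of_subset:
  assumes "compactin T (T closure_of A)" "B \<subseteq> A"
  shows "compactin T (T closure_of B)"
  using assms closed_compactin closedin_closure_of closure_of_mono by metis

text \<open>Openness of the chart images is a hypothesis so that the lemma can be applied to powers
  of a manifold, for which this property is checked separately. Compactness of the support holds
  because a closed subset of a compact set is compact.\<close>

lemma test_functions_lincomb:
  assumes op: "\<And>U c. (U, c) \<in> charts M \<Longrightarrow> openin (Euclidean_space (mdim M)) (c ` U)"
    and f: "f \<in> test_functions M" and h: "h \<in> test_functions M"
  shows "(\<lambda>p. a * f p + b * h p) \<in> test_functions M"
proof -
  have "compactin (mtop M) (mtop M closure_of ({p. f p \<noteq> 0} \<union> {p. h p \<noteq> 0}))"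
    using f h by (simp add: test_functions_def closure_of_Un compactin_Un)
  then have "compactin (mtop M) (mtop M closure_of {p. a * f p + b * h p \<noteq> 0})"
    by (rule compactin_closure_of_subset) auto
  moreover have "{p. a * f p + b * h p \<noteq> 0} \<subseteq> {p. f p \<noteq> 0} \<union> {p. h p \<noteq> 0}"
    by auto
  moreover have "smooth_on (mdim M) (c ` U) (\<lambda>u. a * f (inv_into U c u) + b * h (inv_into U c u))"
    if "(U, c) \<in> charts M" for U c
    using f h that by (intro smooth_on_lincomb op) (auto simp: test_functions_def)
  ultimately show ?thesis
    using f h unfolding test_functions_def by blast
qed

text \<open>On a chart domain \<open>f\<close> is its local expression composed with the coordinate
  map; the chart domains form an open cover, so the pieces paste together.\<close>

lemma test_function_continuous:
  assumes cover: "topspace (mtop M) = (\<Union>(U, c)\<in>charts M. U)"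
    and chart: "\<And>U c. (U, c) \<in> charts M \<Longrightarrow> openin (mtop M) U \<and> inj_on c U \<and>
        continuous_map (subtopology (mtop M) U) (Euclidean_space (mdim M)) c"
    and f: "f \<in> test_functions M"
  shows "continuous_map (mtop M) euclideanreal f"
proof (rule pasting_lemma[where I = "charts M" and T = fst and f = "\<lambda>_. f"])
  fix C assume C: "C \<in> charts M"
  obtain U c where [simp]: "C = (U, c)" by (cases C)
  show "openin (mtop M) (fst C)"
    using chart C by auto
  have "continuous_map (subtopology (mtop M) U) (subtopology (Euclidean_space (mdim M)) (c ` U)) c"
    using chart[of U c] C by (auto simp: continuous_map_in_subtopology)
  \<comment> \<open>The empty list of derivatives yields continuity of the local expression
    itself.\<close>
  moreover have "continuous_map (subtopology (Euclidean_space (mdim M)) (c ` U)) euclideanreal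
      (\<lambda>u. f (inv_into U c u))"
    using f C unfolding test_functions_def smooth_on_def
    by (auto dest!: bspec[of _ _ "(U, c)"] spec[of _ "[]"])
  ultimately have "continuous_map (subtopology (mtop M) U) euclideanreal ((\<lambda>u. f (inv_into U c u)) \<circ> c)"
    by (rule continuous_map_compose)
  then show "continuous_map (subtopology (mtop M) (fst C)) euclideanreal f"
    using chart[of U c] C by (auto elim!: continuous_map_eq)
qed (use cover in auto)


section \<open>Powers of a manifold\<close>

lemma charts_power_manifoldE:
  assumes "(P, E) \<in> charts (power_manifold M n)"
  obtains C where "C \<in> {..<n} \<rightarrow> charts M" "P = PiE {..<n} (\<lambda>i. fst (C i))"
    "E = (\<lambda>x k. if k < n * mdim M
            then snd (C (k div mdim M)) (x (k div mdim M)) (k mod mdim M) else 0)"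
  using assms by (auto simp: power_manifold_def)

lemma charts_power_manifoldI:
  assumes "C \<in> {..<n} \<rightarrow> charts M"
  shows "(PiE {..<n} (\<lambda>i. fst (C i)), \<lambda>x k. if k < n * mdim M
            then snd (C (k div mdim M)) (x (k div mdim M)) (k mod mdim M) else 0)
          \<in> charts (power_manifold M n)"
  unfolding power_manifold_def using assms by (simp, intro exI[of _ C]) simp

lemma mtop_power_manifold [simp]: "mtop (power_manifold M n) = product_topology (\<lambda>_. mtop M) {..<n}"
  and mdim_power_manifold [simp]: "mdim (power_manifold M n) = n * mdim M"
  by (simp_all add: power_manifold_def)

lemma smooth_manifold_chart:
  assumes "smooth_manifold M" "(U, c) \<in> charts M"
  shows "openin (mtop M) U" "openin (Euclidean_space (mdim M)) (c ` U)" "inj_on c U"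
    "continuous_map (subtopology (mtop M) U) (Euclidean_space (mdim M)) c"
proof -
  have *: "openin (mtop M) U \<and> openin (Euclidean_space (mdim M)) (c ` U) \<and>
        homeomorphic_map (subtopology (mtop M) U)
          (subtopology (Euclidean_space (mdim M)) (c ` U)) c"
    using assms unfolding smooth_manifold_def by (metis (no_types, lifting) case_prodD)
  then show "openin (mtop M) U" "openin (Euclidean_space (mdim M)) (c ` U)"
    by auto
  have "U \<subseteq> topspace (mtop M)"
    using * openin_subset by blast
  then show "inj_on c U"
    using homeomorphic_imp_injective_map[of "subtopology (mtop M) U"] *
    by (metis topspace_subtopology_subset)
  show "continuous_map (subtopology (mtop M) U) (Euclidean_space (mdim M)) c"
    using * homeomorphic_imp_continuous_map continuous_map_in_subtopology by metis
qed

lemma power_manifold_cover: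
  assumes "smooth_manifold M"
  shows "topspace (mtop (power_manifold M n)) = (\<Union>(U, c)\<in>charts (power_manifold M n). U)"
proof -
  have cover: "topspace (mtop M) = (\<Union>(U, c)\<in>charts M. U)"
    using assms by (simp add: smooth_manifold_def)
  show ?thesis
  proof (intro equalityI subsetI)
    fix x assume x: "x \<in> topspace (mtop (power_manifold M n))"
    have "\<exists>C. C \<in> charts M \<and> x i \<in> fst C" if "i < n" for i
      using x that cover by (fastforce simp: PiE_iff)
    then obtain C where "\<And>i. i < n \<Longrightarrow> C i \<in> charts M \<and> x i \<in> fst (C i)"
      by metis
    then have "x \<in> PiE {..<n} (\<lambda>i. fst (C i))" "C \<in> {..<n} \<rightarrow> charts M"
      using x by (auto simp: PiE_iff)
    then show "x \<in> (\<Union>(U, c)\<in>charts (power_manifold M n). U)"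
      using charts_power_manifoldI[of C n M] by blast
  next
    fix x assume "x \<in> (\<Union>(U, c)\<in>charts (power_manifold M n). U)"
    then obtain P E where "(P, E) \<in> charts (power_manifold M n)" "x \<in> P"
      by blast
    then obtain C where C: "C \<in> {..<n} \<rightarrow> charts M" and x: "x \<in> PiE {..<n} (\<lambda>i. fst (C i))"
      using charts_power_manifoldE by metis
    have "x i \<in> topspace (mtop M)" if "i < n" for i
    proof -
      have "fst (C i) \<subseteq> topspace (mtop M)"
        using smooth_manifold_chart(1)[OF assms, of "fst (C i)" "snd (C i)"] C that
        by (intro openin_subset) auto
      then show ?thesis using x that by auto
    qed
    then show "x \<in> topspace (mtop (power_manifold M n))"
      using x by (simp add: PiE_iff)
  qed
qed

lemma index_less_mult: "i * d + j < n * d" if "i < n" "j < d" for i j d n :: nat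
proof -
  have "i * d + j < Suc i * d" using that by simp
  also have "\<dots> \<le> n * d" using that by (intro mult_le_mono1) simp
  finally show ?thesis .
qed

text \<open>These are the facts that \<open>test_function_continuous\<close> asks of a chart. They
  are read off blockwise: coordinate \<open>i * mdim M + j\<close> of \<open>E x\<close> is
  coordinate \<open>j\<close> of the chart \<open>C i\<close> at \<open>x i\<close>.\<close>

lemma power_manifold_chart_domain:
  assumes M: "smooth_manifold M" and PE: "(P, E) \<in> charts (power_manifold M n)"
  shows "openin (mtop (power_manifold M n)) P \<and> inj_on E P \<and>
    continuous_map (subtopology (mtop (power_manifold M n)) P) (Euclidean_space (mdim (power_manifold M n))) E"
proof -
  let ?d = "mdim M"
  obtain C where C: "C \<in> {..<n} \<rightarrow> charts M" and P: "P = PiE {..<n} (\<lambda>i. fst (C i))"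
    and E: "E = (\<lambda>x k. if k < n * ?d then snd (C (k div ?d)) (x (k div ?d)) (k mod ?d) else 0)"
    using charts_power_manifoldE[OF PE] .
  have Ci: "(fst (C i), snd (C i)) \<in> charts M" if "i < n" for i
    using C that by auto
  note chart = smooth_manifold_chart[OF M Ci]
  have "openin (mtop (power_manifold M n)) P"
    unfolding P using chart(1) by (auto simp: openin_PiE_gen)
  moreover have "inj_on E P"
  proof (rule inj_onI)
    fix x y assume x: "x \<in> P" and y: "y \<in> P" and eq: "E x = E y"
    have "x i = y i" if i: "i < n" for i
    proof -
      have "snd (C i) (x i) j = snd (C i) (y i) j" for j
      proof (cases "j < ?d")
        case True
        then show ?thesis
          using fun_cong[OF eq, of "i * ?d + j"] index_less_mult[OF i True] by (simp add: E)
      next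
        \<comment> \<open>Both coordinate vectors lie in \<open>Euclidean_space\<close>, so beyond
          the dimension both entries are 0.\<close>
        case False
        have "snd (C i) (x i) \<in> topspace (Euclidean_space ?d)" "snd (C i) (y i) \<in> topspace (Euclidean_space ?d)"
          using openin_subset[OF chart(2)[OF i]] x y i by (auto simp: P)
        then show ?thesis
          using False by (simp add: topspace_Euclidean_space)
      qed
      then show ?thesis
        using inj_onD[OF chart(3)[OF i], of "x i" "y i"] x y i by (auto simp: P fun_eq_iff PiE_iff)
    qed
    then show "x = y"
      using x y by (intro PiE_ext[of x "{..<n}" "\<lambda>i. fst (C i)"]) (auto simp: P)
  qed
  moreover have "continuous_map (subtopology (mtop (power_manifold M n)) P) (Euclidean_space (n * ?d)) E"
    unfolding E continuous_map_componentwise_Euclidean_space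
  proof (intro allI impI)
    fix k assume k: "k < n * ?d"
    define i where "i = k div ?d"
    have i: "i < n"
      using k by (simp add: i_def less_mult_imp_div_less)
    have "continuous_map (subtopology (mtop (power_manifold M n)) P) (subtopology (mtop M) (fst (C i))) (\<lambda>x. x i)"
      using i by (auto simp: continuous_map_in_subtopology P
          intro!: continuous_map_from_subtopology continuous_map_product_projection)
    moreover have "continuous_map (subtopology (mtop M) (fst (C i))) euclideanreal (\<lambda>p. snd (C i) p (k mod ?d))"
      using chart(4)[OF i] unfolding Euclidean_space_def continuous_map_in_subtopology
      by (auto simp: continuous_map_componentwise_UNIV)
    ultimately show "continuous_map (subtopology (mtop (power_manifold M n)) P) euclideanreal
        (\<lambda>x. snd (C (k div ?d)) (x (k div ?d)) (k mod ?d))"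
      unfolding i_def by (rule continuous_map_compose[unfolded comp_def])
  qed
  ultimately show ?thesis by simp
qed

text \<open>The image is a finite intersection of preimages: \<open>u\<close> belongs to it exactly
  when every block of \<open>u\<close> lies in the open image of the corresponding chart.\<close>

lemma power_manifold_chart_image_open:
  assumes M: "smooth_manifold M" and PE: "(P, E) \<in> charts (power_manifold M n)"
  shows "openin (Euclidean_space (mdim (power_manifold M n))) (E ` P)"
proof -
  let ?d = "mdim M" and ?T = "Euclidean_space (n * mdim M)"
  obtain C where C: "C \<in> {..<n} \<rightarrow> charts M" and P: "P = PiE {..<n} (\<lambda>i. fst (C i))"
    and E: "E = (\<lambda>x k. if k < n * ?d then snd (C (k div ?d)) (x (k div ?d)) (k mod ?d) else 0)"
    using charts_power_manifoldE[OF PE] .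
  have Ci: "(fst (C i), snd (C i)) \<in> charts M" if "i < n" for i
    using C that by auto
  note chart = smooth_manifold_chart[OF M Ci]
  define block where "block = (\<lambda>i (u :: nat \<Rightarrow> real) j. if j < ?d then u (i * ?d + j) else 0)"
  define B where "B = (\<lambda>i. {u \<in> topspace ?T. block i u \<in> snd (C i) ` fst (C i)})"
  have "openin ?T (B i)" if i: "i < n" for i
  proof -
    have "continuous_map ?T (Euclidean_space ?d) (block i)"
      unfolding block_def continuous_map_componentwise_Euclidean_space
      unfolding Euclidean_space_def
      by (auto intro!: continuous_map_from_subtopology continuous_map_product_projection)
    then show ?thesis
      unfolding B_def using chart(2)[OF i] by (rule openin_continuous_map_preimage)
  qed
  \<comment> \<open>The factor \<open>topspace ?T\<close> matters for \<open>n = 0\<close>, where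
    the intersection over the empty index set is the universe.\<close>
  then have "openin ?T ((\<Inter>i\<in>{..<n}. B i) \<inter> topspace ?T)"
    by (intro openin_INT) auto
  moreover have "E ` P = (\<Inter>i\<in>{..<n}. B i) \<inter> topspace ?T"
  proof (intro equalityI subsetI)
    fix u assume "u \<in> E ` P"
    then obtain x where x: "x \<in> P" and u: "u = E x" by auto
    have top: "u \<in> topspace ?T"
      by (auto simp: u E topspace_Euclidean_space)
    have "block i u = snd (C i) (x i)" if i: "i < n" for i
    proof -
      have "snd (C i) (x i) \<in> topspace (Euclidean_space ?d)"
        using openin_subset[OF chart(2)[OF i]] x i by (auto simp: P)
      then show ?thesis
        using index_less_mult[OF i]
        by (auto simp: block_def u E topspace_Euclidean_space fun_eq_iff)
    qed
    then show "u \<in> (\<Inter>i\<in>{..<n}. B i) \<inter> topspace ?T"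
      using top x by (auto simp: B_def P)
  next
    fix u assume u: "u \<in> (\<Inter>i\<in>{..<n}. B i) \<inter> topspace ?T"
    then have "\<forall>i. \<exists>y. i < n \<longrightarrow> y \<in> fst (C i) \<and> snd (C i) y = block i u"
      by (force simp: B_def)
    then obtain y where y: "\<And>i. i < n \<Longrightarrow> y i \<in> fst (C i) \<and> snd (C i) (y i) = block i u"
      by metis
    have "E (restrict y {..<n}) = u"
    proof
      fix k show "E (restrict y {..<n}) k = u k"
      proof (cases "k < n * ?d")
        case True
        \<comment> \<open>This gives \<open>k mod ?d < ?d\<close>; dimension 0 is excluded by
          \<open>k < n * ?d\<close>.\<close>
        then have "?d > 0" by (cases ?d) auto
        then show ?thesis
          using True y[of "k div ?d"] by (simp add: E block_def less_mult_imp_div_less)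
      next
        case False
        then show ?thesis
          using u by (simp add: E topspace_Euclidean_space)
      qed
    qed
    moreover have "restrict y {..<n} \<in> P"
      using y by (auto simp: P)
    ultimately show "u \<in> E ` P" by blast
  qed
  ultimately show ?thesis by simp
qed

lemma test_functions_power_lincomb:
  assumes "smooth_manifold M"
    and "f \<in> test_functions (power_manifold M n)" "h \<in> test_functions (power_manifold M n)"
  shows "(\<lambda>p. a * f p + b * h p) \<in> test_functions (power_manifold M n)"
  using assms by (intro test_functions_lincomb power_manifold_chart_image_open)

lemma test_functions_power_continuous:
  assumes "smooth_manifold M" "f \<in> test_functions (power_manifold M n)"
  shows "continuous_map (product_topology (\<lambda>_. mtop M) {..<n}) euclideanreal f"
  using test_function_continuous[OF power_manifold_cover power_manifold_chart_domain] assms by simp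


section \<open>Finite configurations\<close>

lemma config_cong: "(\<And>i. i \<in> I \<Longrightarrow> x i = y i) \<Longrightarrow> config x I = config y I"
  unfolding config_def by (cases "finite I") (auto intro: image_mset_cong)

lemma size_config [simp]: "size (config x I) = card I"
  by (simp add: config_def)

lemma set_mset_config: "finite I \<Longrightarrow> set_mset (config x I) = x ` I"
  by (simp add: config_def)

lemma config_image: "inj_on p I \<Longrightarrow> config x (p ` I) = config (x \<circ> p) I"
  by (simp add: config_def image_mset_mset_set[symmetric] multiset.map_comp)

text \<open>A list with the given multiset supplies the point; \<open>restrict\<close> makes it
  extensional, as elements of \<open>PiE\<close> must be.\<close>

lemma config_surj:
  assumes "set_mset \<eta> \<subseteq> A"
  obtains x where "x \<in> PiE {..<size \<eta>} (\<lambda>_. A)" "config x {..<size \<eta>} = \<eta>"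
proof -
  obtain xs where xs: "mset xs = \<eta>"
    using ex_mset by blast
  have "config (restrict ((!) xs) {..<size \<eta>}) {..<size \<eta>} = config ((!) xs) {..<size \<eta>}"
    by (rule config_cong) simp
  also have "\<dots> = mset (map ((!) xs) [0..<length xs])"
    unfolding xs[symmetric] by (simp add: config_def lessThan_atLeast0 flip: mset_upt)
  also have "\<dots> = \<eta>"
    by (simp only: map_nth xs)
  finally show thesis
    using assms xs by (intro that[of "restrict ((!) xs) {..<size \<eta>}"]) auto
qed

section \<open>Ordered splittings of an index set and the convolution\<close>

definition ordered_splits :: "nat \<Rightarrow> (nat set \<times> nat set \<times> nat set) set" where
  "ordered_splits n = {(I\<^sub>1, I\<^sub>2, I\<^sub>3). I\<^sub>1 \<union> I\<^sub>2 \<union> I\<^sub>3 = {..<n} \<and>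
     I\<^sub>1 \<inter> I\<^sub>2 = {} \<and> I\<^sub>1 \<inter> I\<^sub>3 = {} \<and> I\<^sub>2 \<inter> I\<^sub>3 = {}}"

lemma ordered_splits_subset: "ordered_splits n \<subseteq> Pow {..<n} \<times> Pow {..<n} \<times> Pow {..<n}"
  by (auto simp: ordered_splits_def)

lemma finite_ordered_splits [simp]: "finite (ordered_splits n)"
  by (rule finite_subset[OF ordered_splits_subset]) auto

text \<open>Each of the three parts is one of \<open>2 ^ n\<close> subsets. The exact count is
  \<open>3 ^ n\<close>, but any bound in terms of \<open>n\<close> serves the estimate of
  convolutions.\<close>

lemma card_ordered_splits_le: "card (ordered_splits n) \<le> 8 ^ n"
proof -
  have "card (ordered_splits n) \<le> card (Pow {..<n} \<times> Pow {..<n} \<times> Pow {..<n})"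
    by (intro card_mono ordered_splits_subset) auto
  also have "\<dots> = 8 ^ n"
    by (simp add: card_cartesian_product card_Pow power_mult_distrib[symmetric])
  finally show ?thesis .
qed

lemma ordered_splits_permute:
  assumes p: "p permutes {..<n}" and I: "(I, J, L) \<in> ordered_splits n"
  shows "(p ` I, p ` J, p ` L) \<in> ordered_splits n"
proof -
  have "inj p" using p by (rule permutes_inj)
  moreover have "p ` (I \<union> J \<union> L) = {..<n}"
    using I permutes_image[OF p] by (simp add: ordered_splits_def)
  ultimately show ?thesis
    using I by (simp add: ordered_splits_def image_Un image_Int[symmetric])
qed

text \<open>\<open>star\<close> evaluates along an enumeration picked by \<open>SOME\<close>. Two
  enumerations of one multiset differ by a permutation, which merely rearranges the splittings, so
  any enumeration may be used. This frees the continuity and support arguments from the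
  choice.\<close>

lemma star_config:
  "(G \<star> H) (config x {..<n}) =
     (\<Sum>(I, J, L)\<in>ordered_splits n. G (config x (I \<union> J)) * H (config x (J \<union> L)))"
proof -
  define y where "y = (SOME y. config y {..<n} = config x {..<n})"
  have "config y {..<n} = config x {..<n}"
    unfolding y_def by (rule someI[of _ x]) simp
  then obtain p where p: "p permutes {..<n}" and yx: "\<forall>i\<in>{..<n}. y i = x (p i)"
    unfolding config_def by (rule image_mset_eq_implies_permutes[OF finite_lessThan])
  define q where "q = inv_into UNIV p"
  have p': "q permutes {..<n}" and inj: "inj p"
    using p permutes_inv permutes_inj by (auto simp: q_def)
  have y: "config y I = config x (p ` I)" if "I \<subseteq> {..<n}" for I
  proof -
    have "config y I = config (x \<circ> p) I"
      using that yx by (intro config_cong) auto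
    then show ?thesis
      using config_image[of p I x] inj by (simp add: inj_on_subset)
  qed
  have "(G \<star> H) (config x {..<n}) =
      (\<Sum>(I, J, L)\<in>ordered_splits n. G (config y (I \<union> J)) * H (config y (J \<union> L)))"
    by (simp add: star_def y_def ordered_splits_def Let_def)
  also have "\<dots> = (\<Sum>(I, J, L)\<in>ordered_splits n. G (config x (p ` I \<union> p ` J)) * H (config x (p ` J \<union> p ` L)))"
  proof (intro sum.cong refl, clarify)
    fix I J L assume "(I, J, L) \<in> ordered_splits n"
    then have "I \<union> J \<subseteq> {..<n}" "J \<union> L \<subseteq> {..<n}" by (auto simp: ordered_splits_def)
    then show "G (config y (I \<union> J)) * H (config y (J \<union> L)) =
        G (config x (p ` I \<union> p ` J)) * H (config x (p ` J \<union> p ` L))"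
      by (simp add: y image_Un)
  qed
  \<comment> \<open>Taking images under \<open>p\<close> is a bijection of the splittings, with
    images under \<open>q\<close> as its inverse.\<close>
  also have "\<dots> = (\<Sum>(I, J, L)\<in>ordered_splits n. G (config x (I \<union> J)) * H (config x (J \<union> L)))"
  proof -
    have "p \<circ> q = id" "q \<circ> p = id"
      unfolding q_def using p by (rule permutes_inv_o)+
    then have *: "p ` q ` I = I" "q ` p ` I = I" for I
      by (simp_all only: image_comp image_id id_apply)
    show ?thesis
      by (rule sum.reindex_bij_witness[where
            i = "\<lambda>(I, J, L). (q ` I, q ` J, q ` L)" and
            j = "\<lambda>(I, J, L). (p ` I, p ` J, p ` L)"])
        (use ordered_splits_permute[OF p] ordered_splits_permute[OF p'] in \<open>simp_all add: * del: image_image split: prod.splits, blast, blast\<close>)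
  qed
  finally show ?thesis .
qed

text \<open>A term survives only if its second and third parts are empty, and there is exactly one
  such splitting: the vacuum is the unit of the convolution.\<close>

lemma star_empty_indicator:
  "G \<star> (\<lambda>\<eta>. if \<eta> = {#} then 1 else 0) = G"
proof
  fix \<eta> :: "'a multiset"
  obtain x where x: "config x {..<size \<eta>} = \<eta>"
    using config_surj[of \<eta> UNIV] by auto
  let ?n = "size \<eta>" and ?\<Omega> = "\<lambda>\<eta> :: 'a multiset. if \<eta> = {#} then 1 else (0 :: complex)"
  have "(G \<star> ?\<Omega>) \<eta> =
      (\<Sum>(I, J, L)\<in>ordered_splits ?n. G (config x (I \<union> J)) * ?\<Omega> (config x (J \<union> L)))"
    using star_config[of G ?\<Omega> x ?n] by (simp only: x)
  also have "\<dots> = (\<Sum>(I, J, L)\<in>{({..<?n}, {}, {})}. G (config x (I \<union> J)) * ?\<Omega> (config x (J \<union> L)))"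
  proof (rule sum.mono_neutral_right)
    show "\<forall>s\<in>ordered_splits ?n - {({..<?n}, {}, {})}.
        (case s of (I, J, L) \<Rightarrow> G (config x (I \<union> J)) * ?\<Omega> (config x (J \<union> L))) = 0"
    proof
      fix s assume s: "s \<in> ordered_splits ?n - {({..<?n}, {}, {})}"
      obtain I J L where [simp]: "s = (I, J, L)" by (cases s)
      have "J \<union> L \<noteq> {}" "finite (J \<union> L)"
        using s finite_subset[of "J \<union> L" "{..<?n}"] by (auto simp: ordered_splits_def)
      then have "size (config x (J \<union> L)) \<noteq> 0"
        by (simp only: size_config card_eq_0_iff) simp
      then have "config x (J \<union> L) \<noteq> {#}"
        by (intro notI) simp
      then show "(case s of (I, J, L) \<Rightarrow> G (config x (I \<union> J)) * ?\<Omega> (config x (J \<union> L))) = 0"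
        by simp
    qed
  qed (simp, auto simp: ordered_splits_def)
  also have "\<dots> = G \<eta>"
    by (simp add: x) (simp add: config_def)
  finally show "(G \<star> ?\<Omega>) \<eta> = G \<eta>" .
qed

lemma ordered_splits_commute: "(I, J, L) \<in> ordered_splits n \<Longrightarrow> (L, J, I) \<in> ordered_splits n"
  by (auto simp: ordered_splits_def)

text \<open>The first and third parts of a splitting exchange roles. This is the source of the
  hermitian symmetry of the form.\<close>

lemma star_commute: "G \<star> H = H \<star> G"
proof
  fix \<eta> :: "'a multiset"
  obtain x where x: "config x {..<size \<eta>} = \<eta>"
    using config_surj[of \<eta> UNIV] by auto
  have "(\<Sum>(I, J, L)\<in>ordered_splits (size \<eta>). G (config x (I \<union> J)) * H (config x (J \<union> L))) =
      (\<Sum>(I, J, L)\<in>ordered_splits (size \<eta>). H (config x (I \<union> J)) * G (config x (J \<union> L)))"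
    by (rule sum.reindex_bij_witness[where i = "\<lambda>(I, J, L). (L, J, I)" and j = "\<lambda>(I, J, L). (L, J, I)"])
      (auto intro: ordered_splits_commute simp: Un_commute mult.commute)
  then show "(G \<star> H) \<eta> = (H \<star> G) \<eta>"
    by (simp only: star_config[of G H x "size \<eta>", unfolded x] star_config[of H G x "size \<eta>", unfolded x])
qed

lemma star_lincomb_left:
  "((\<lambda>\<eta>. a * G \<eta> + b * G' \<eta>) \<star> H) \<eta> = a * (G \<star> H) \<eta> + b * (G' \<star> H) \<eta>"
  by (simp add: star_def Let_def split_def distrib_right sum.distrib sum_distrib_left mult.assoc)

lemma cnj_star: "cnj ((G \<star> H) \<eta>) = (conj_fun G \<star> conj_fun H) \<eta>"
  by (simp add: star_def Let_def conj_fun_def split_def)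

lemma conj_fun_conj_fun [simp]: "conj_fun (conj_fun G) = G"
  by (simp add: conj_fun_def fun_eq_iff)

section \<open>Topology of the configuration space and continuous functions on it\<close>

lemma openin_config_topology: "openin (config_topology X) = config_open X"
  unfolding config_topology_def by (rule topology_inverse'[OF istopology_config_open])

lemma config_in_topspace:
  "x \<in> PiE {..<n} (\<lambda>_. A) \<Longrightarrow> I \<subseteq> {..<n} \<Longrightarrow> set_mset (config x I) \<subseteq> A"
  using set_mset_config[OF finite_subset[OF _ finite_lessThan], of I n x] by auto

lemma topspace_config_topology: "topspace (config_topology X) = {\<eta>. set_mset \<eta> \<subseteq> topspace (mtop X)}"
proof (rule antisym)
  show "topspace (config_topology X) \<subseteq> {\<eta>. set_mset \<eta> \<subseteq> topspace (mtop X)}"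
    using openin_topspace[of "config_topology X"] by (simp add: openin_config_topology config_open_def)
  have "{x \<in> topspace (mtop (power_manifold X n)). set_mset (config x {..<n}) \<subseteq> topspace (mtop X)}
      = topspace (mtop (power_manifold X n))" for n
    using config_in_topspace[of _ n "topspace (mtop X)" "{..<n}"] by auto
  then have "openin (config_topology X) {\<eta>. set_mset \<eta> \<subseteq> topspace (mtop X)}"
    unfolding openin_config_topology config_open_def mem_Collect_eq by (metis openin_topspace order_refl)
  then show "{\<eta>. set_mset \<eta> \<subseteq> topspace (mtop X)} \<subseteq> topspace (config_topology X)"
    by (rule openin_subset)
qed

text \<open>The universal property of a final topology: openness of a set of configurations is
  tested on each power of the manifold. That the values lie in \<open>Y\<close> follows because
  every configuration comes from a point of some power.\<close>

lemma continuous_map_config_topology: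
  assumes "\<And>n. continuous_map (product_topology (\<lambda>_. mtop X) {..<n}) Y (\<lambda>x. f (config x {..<n}))"
  shows "continuous_map (config_topology X) Y f"
  unfolding continuous_map_def
proof (intro conjI allI impI)
  show "f \<in> topspace (config_topology X) \<rightarrow> topspace Y"
  proof
    fix \<eta> assume "\<eta> \<in> topspace (config_topology X)"
    then have "set_mset \<eta> \<subseteq> topspace (mtop X)"
      by (simp add: topspace_config_topology)
    then obtain x where "x \<in> PiE {..<size \<eta>} (\<lambda>_. topspace (mtop X))" "config x {..<size \<eta>} = \<eta>"
      by (rule config_surj)
    then show "f \<eta> \<in> topspace Y"
      using continuous_map_funspace[OF assms[of "size \<eta>"]] by (auto simp: Pi_iff)
  qed
  fix U assume U: "openin Y U"
  have "openin (mtop (power_manifold X n)) {x \<in> topspace (mtop (power_manifold X n)).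
      config x {..<n} \<in> {\<eta> \<in> topspace (config_topology X). f \<eta> \<in> U}}" for n
  proof -
    have "{x \<in> topspace (mtop (power_manifold X n)).
        config x {..<n} \<in> {\<eta> \<in> topspace (config_topology X). f \<eta> \<in> U}} =
        {x \<in> topspace (product_topology (\<lambda>_. mtop X) {..<n}). f (config x {..<n}) \<in> U}"
      using config_in_topspace[of _ n "topspace (mtop X)" "{..<n}"] by (auto simp: topspace_config_topology)
    then show ?thesis
      using openin_continuous_map_preimage[OF assms U] by simp
  qed
  then show "openin (config_topology X) {\<eta> \<in> topspace (config_topology X). f \<eta> \<in> U}"
    unfolding openin_config_topology config_open_def by (auto simp: topspace_config_topology)
qed

text \<open>The configuration sees only the coordinates in \<open>J\<close>. An enumeration of
  \<open>J\<close> turns the function into a projection to a smaller power followed by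
  \<open>component X G (card J)\<close>; the terms of a convolution are products of such
  functions.\<close>

lemma continuous_map_component_config:
  assumes cont: "\<And>n. continuous_map (product_topology (\<lambda>_. mtop X) {..<n}) euclidean (component X G n)"
    and J: "J \<subseteq> {..<n}"
  shows "continuous_map (product_topology (\<lambda>_. mtop X) {..<n}) euclidean (\<lambda>x. G (config x J))"
proof -
  have "finite J" using J finite_subset by blast
  then obtain e where e: "bij_betw e {..<card J} J"
    using ex_bij_betw_nat_finite[of J] by (auto simp: lessThan_atLeast0)
  then have eJ: "e i < n" if "i < card J" for i
    using that J by (auto simp: bij_betw_def)
  let ?r = "\<lambda>x. restrict (x \<circ> e) {..<card J}"
  have r: "continuous_map (product_topology (\<lambda>_. mtop X) {..<n}) (product_topology (\<lambda>_. mtop X) {..<card J}) ?r"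
    unfolding continuous_map_componentwise using eJ
    by (auto intro!: continuous_map_product_projection)
  have "continuous_map (product_topology (\<lambda>_. mtop X) {..<n}) euclidean (component X G (card J) \<circ> ?r)"
    using r cont by (rule continuous_map_compose)
  then show ?thesis
  proof (rule continuous_map_eq)
    fix x assume "x \<in> topspace (product_topology (\<lambda>_. mtop X) {..<n})"
    then have "?r x \<in> topspace (product_topology (\<lambda>_. mtop X) {..<card J})"
      using continuous_map_funspace[OF r] by blast
    moreover have "config (?r x) {..<card J} = config x J"
    proof -
      have "config (?r x) {..<card J} = config (x \<circ> e) {..<card J}"
        by (rule config_cong) simp
      also have "\<dots> = config x J"
        using e config_image[of e "{..<card J}" x] by (simp add: bij_betw_def)
      finally show ?thesis .
    qed
    ultimately show "(component X G (card J) \<circ> ?r) x = G (config x J)"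
      by (simp add: component_def)
  qed
qed

text \<open>The properties of finite sequences from which integrability of convolutions is derived.
  They are evidently stable under conjugation, so both factors of
  \<open>G \<star> conj_fun H\<close> can be treated alike.\<close>

definition Cc_configs :: "'p manifold \<Rightarrow> ('p multiset \<Rightarrow> complex) set" where
  "Cc_configs X = {G.
     (\<forall>n. continuous_map (product_topology (\<lambda>_. mtop X) {..<n}) euclidean (component X G n)) \<and>
     (\<exists>N \<Lambda>. compactin (mtop X) \<Lambda> \<and> (\<forall>\<eta>. G \<eta> \<noteq> 0 \<longrightarrow> size \<eta> \<le> N \<and> set_mset \<eta> \<subseteq> \<Lambda>))}"

lemma Cc_configs_continuous:
  "G \<in> Cc_configs X \<Longrightarrow>
    continuous_map (product_topology (\<lambda>_. mtop X) {..<n}) euclidean (component X G n)"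
  unfolding Cc_configs_def by blast

lemma Cc_configs_supportE:
  assumes "G \<in> Cc_configs X"
  obtains N \<Lambda> where "compactin (mtop X) \<Lambda>"
    "\<And>\<eta>. G \<eta> \<noteq> 0 \<Longrightarrow> size \<eta> \<le> N \<and> set_mset \<eta> \<subseteq> \<Lambda>"
  using assms unfolding Cc_configs_def by blast

lemma conj_fun_Cc_configs: "G \<in> Cc_configs X \<Longrightarrow> conj_fun G \<in> Cc_configs X"
proof -
  assume G: "G \<in> Cc_configs X"
  have eq: "component X (conj_fun G) n = cnj \<circ> component X G n" for n
    by (auto simp: component_def conj_fun_def)
  have "continuous_map euclidean euclidean cnj"
    by (simp add: continuous_on_cnj)
  then have "continuous_map (product_topology (\<lambda>_. mtop X) {..<n}) euclidean (component X (conj_fun G) n)" for n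
    unfolding eq by (rule continuous_map_compose[OF Cc_configs_continuous[OF G]])
  moreover have "conj_fun G \<eta> \<noteq> 0 \<longleftrightarrow> G \<eta> \<noteq> 0" for \<eta>
    by (simp add: conj_fun_def)
  ultimately show ?thesis
    using G unfolding Cc_configs_def by simp
qed

text \<open>Supports are compact in the powers, while \<open>Cc_configs\<close> wants a compact set
  in the manifold. The union of all coordinate projections of the finitely many supports is such a
  set, since projections preserve compactness.\<close>

lemma F_fin_subset_Cc_configs:
  assumes X: "smooth_manifold X" and G: "G \<in> F_fin X"
  shows "G \<in> Cc_configs X"
proof -
  let ?P = "\<lambda>n. product_topology (\<lambda>_. mtop X) {..<n}"
  let ?R = "\<lambda>n x. Re (component X G n x)" and ?I = "\<lambda>n x. Im (component X G n x)"
  have R: "?R n \<in> test_functions (power_manifold X n)" and I: "?I n \<in> test_functions (power_manifold X n)" for n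
    using G by (auto simp: F_fin_def)
  have cont: "continuous_map (?P n) euclidean (component X G n)" for n
  proof -
    have "continuous_map (?P n) euclidean (\<lambda>x. Complex (?R n x) (?I n x))"
      using test_functions_power_continuous[OF X R] test_functions_power_continuous[OF X I]
      unfolding continuous_map_atin limitin_canonical_iff by (intro ballI tendsto_Complex; blast)
    then show ?thesis by simp
  qed
  obtain N where N: "\<And>\<eta>. size \<eta> > N \<Longrightarrow> G \<eta> = 0"
    using G by (auto simp: F_fin_def)
  define S where "S = (\<lambda>n. ?P n closure_of {x. ?R n x \<noteq> 0} \<union> ?P n closure_of {x. ?I n x \<noteq> 0})"
  have S: "compactin (?P n) (S n)" for n
    using R[of n] I[of n] by (auto simp: S_def test_functions_def intro: compactin_Un)
  define \<Lambda> where "\<Lambda> = (\<Union>n\<in>{..N}. \<Union>i\<in>{..<n}. (\<lambda>x. x i) ` S n)"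
  have "compactin (mtop X) ((\<lambda>x. x i) ` S n)" if "i < n" for i n
    using that by (intro image_compactin[OF S] continuous_map_product_projection) auto
  then have "compactin (mtop X) \<Lambda>"
    unfolding \<Lambda>_def by (auto intro!: compactin_Union)
  moreover have "size \<eta> \<le> N \<and> set_mset \<eta> \<subseteq> \<Lambda>" if "G \<eta> \<noteq> 0" for \<eta>
  proof -
    have n: "size \<eta> \<le> N"
      using N that leI by blast
    have "set_mset \<eta> \<subseteq> topspace (mtop X)"
      using G that by (auto simp: F_fin_def)
    then obtain x where x: "x \<in> PiE {..<size \<eta>} (\<lambda>_. topspace (mtop X))" "config x {..<size \<eta>} = \<eta>"
      by (rule config_surj)
    then have "component X G (size \<eta>) x \<noteq> 0"
      using that by (simp add: component_def)
    then have "?R (size \<eta>) x \<noteq> 0 \<or> ?I (size \<eta>) x \<noteq> 0"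
      by (simp add: complex_eq_iff)
    moreover have "{x. ?R (size \<eta>) x \<noteq> 0} \<subseteq> topspace (?P (size \<eta>))" "{x. ?I (size \<eta>) x \<noteq> 0} \<subseteq> topspace (?P (size \<eta>))"
      using R[of "size \<eta>"] I[of "size \<eta>"] by (auto simp: test_functions_def)
    ultimately have "x \<in> S (size \<eta>)"
      unfolding S_def using closure_of_subset by blast
    moreover have "set_mset \<eta> = x ` {..<size \<eta>}"
      using x(2) set_mset_config[of "{..<size \<eta>}" x] by simp
    ultimately show ?thesis
      using n by (auto simp: \<Lambda>_def)
  qed
  ultimately show ?thesis
    unfolding Cc_configs_def using cont by blast
qed

text \<open>Each component is continuous on the compact power of \<open>\<Lambda>\<close>, and only
  finitely many degrees contribute nonzero values.\<close>

lemma Cc_configs_bounded: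
  assumes G: "G \<in> Cc_configs X"
  obtains B where "\<And>\<eta>. cmod (G \<eta>) \<le> B"
proof -
  obtain N \<Lambda> where \<Lambda>: "compactin (mtop X) \<Lambda>" and supp: "\<And>\<eta>. G \<eta> \<noteq> 0 \<Longrightarrow> size \<eta> \<le> N \<and> set_mset \<eta> \<subseteq> \<Lambda>"
    by (rule Cc_configs_supportE[OF G], rule that)
  have "bounded (component X G n ` PiE {..<n} (\<lambda>_. \<Lambda>))" for n
  proof -
    have "compactin (product_topology (\<lambda>_. mtop X) {..<n}) (PiE {..<n} (\<lambda>_. \<Lambda>))"
      using \<Lambda> by (simp add: compactin_PiE)
    then have "compactin euclidean (component X G n ` PiE {..<n} (\<lambda>_. \<Lambda>))"
      by (rule image_compactin[OF _ Cc_configs_continuous[OF G]])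
    then show ?thesis
      by (simp add: compact_imp_bounded)
  qed
  then have "bounded (\<Union>n\<in>{..N}. component X G n ` PiE {..<n} (\<lambda>_. \<Lambda>))"
    by (intro bounded_UN) auto
  then obtain B where B: "\<forall>z\<in>(\<Union>n\<in>{..N}. component X G n ` PiE {..<n} (\<lambda>_. \<Lambda>)). cmod z \<le> B"
    unfolding bounded_iff by (rule exE)
  \<comment> \<open>The maximum with 0 also covers configurations at which \<open>G\<close>
    vanishes.\<close>
  have "cmod (G \<eta>) \<le> max B 0" for \<eta>
  proof (cases "G \<eta> = 0")
    case False
    then have "set_mset \<eta> \<subseteq> \<Lambda>"
      using supp by blast
    then obtain x where x: "x \<in> PiE {..<size \<eta>} (\<lambda>_. \<Lambda>)" "config x {..<size \<eta>} = \<eta>"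
      by (rule config_surj)
    have "x \<in> PiE {..<size \<eta>} (\<lambda>_. topspace (mtop X))"
      by (rule subsetD[OF PiE_mono x(1)]) (rule compactin_subset_topspace[OF \<Lambda>])
    then have "component X G (size \<eta>) x = G \<eta>"
      using x(2) by (simp add: component_def)
    then have "G \<eta> \<in> component X G (size \<eta>) ` PiE {..<size \<eta>} (\<lambda>_. \<Lambda>)"
      using image_eqI[OF _ x(1), of "G \<eta>" "component X G (size \<eta>)"] by simp
    then have "cmod (G \<eta>) \<le> B"
      using supp[OF False] by (intro B[rule_format] UN_I[of "size \<eta>"]) auto
    then show ?thesis by simp
  qed auto
  then show thesis by (rule that)
qed

lemma continuous_map_complex_mult:
  fixes f g :: "'a \<Rightarrow> complex"
  shows "continuous_map T euclidean f \<Longrightarrow> continuous_map T euclidean g \<Longrightarrow>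
    continuous_map T euclidean (\<lambda>x. f x * g x)"
  by (simp add: continuous_map_atin tendsto_mult)

lemma star_continuous:
  assumes G: "G \<in> Cc_configs X" and H: "H \<in> Cc_configs X"
  shows "continuous_map (config_topology X) euclidean (G \<star> H)"
proof (rule continuous_map_config_topology)
  fix n
  have "continuous_map (product_topology (\<lambda>_. mtop X) {..<n}) euclidean
      (\<lambda>x. \<Sum>s\<in>ordered_splits n. G (config x (fst s \<union> fst (snd s))) * H (config x (fst (snd s) \<union> snd (snd s))))"
  proof (intro continuous_map_sum continuous_map_complex_mult finite_ordered_splits)
    fix s assume "s \<in> ordered_splits n"
    then have "fst s \<union> fst (snd s) \<subseteq> {..<n}" "fst (snd s) \<union> snd (snd s) \<subseteq> {..<n}"
      by (auto simp: ordered_splits_def)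
    then show "continuous_map (product_topology (\<lambda>_. mtop X) {..<n}) euclidean (\<lambda>x. G (config x (fst s \<union> fst (snd s))))"
      "continuous_map (product_topology (\<lambda>_. mtop X) {..<n}) euclidean (\<lambda>x. H (config x (fst (snd s) \<union> snd (snd s))))"
      by (simp_all add: continuous_map_component_config Cc_configs_continuous[OF G] Cc_configs_continuous[OF H])
  qed
  then show "continuous_map (product_topology (\<lambda>_. mtop X) {..<n}) euclidean (\<lambda>x. (G \<star> H) (config x {..<n}))"
    by (simp add: star_config split_def)
qed

text \<open>A nonzero term writes the configuration as a union of two parts, possibly overlapping,
  one in the support of \<open>G\<close> and one in that of \<open>H\<close>. So the size is at most
  the sum of the two size bounds, and the points lie in the union of the two compact sets. The
  number of terms is then bounded uniformly, and with it the sum.\<close>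

lemma star_support_bound:
  assumes G: "G \<in> Cc_configs X" and H: "H \<in> Cc_configs X"
  obtains N \<Lambda> B where "compactin (mtop X) \<Lambda>" "\<And>\<eta>. cmod ((G \<star> H) \<eta>) \<le> B"
    "\<And>\<eta>. (G \<star> H) \<eta> \<noteq> 0 \<Longrightarrow> size \<eta> \<le> N \<and> set_mset \<eta> \<subseteq> \<Lambda>"
proof -
  obtain N \<Lambda> where \<Lambda>: "compactin (mtop X) \<Lambda>" and suppG: "\<And>\<eta>. G \<eta> \<noteq> 0 \<Longrightarrow> size \<eta> \<le> N \<and> set_mset \<eta> \<subseteq> \<Lambda>"
    by (rule Cc_configs_supportE[OF G], rule that)
  obtain N' \<Lambda>' where \<Lambda>': "compactin (mtop X) \<Lambda>'" and suppH: "\<And>\<eta>. H \<eta> \<noteq> 0 \<Longrightarrow> size \<eta> \<le> N' \<and> set_mset \<eta> \<subseteq> \<Lambda>'"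
    by (rule Cc_configs_supportE[OF H], rule that)
  obtain B where B: "\<And>\<eta>. cmod (G \<eta>) \<le> B" using Cc_configs_bounded[OF G] by blast
  obtain B' where B': "\<And>\<eta>. cmod (H \<eta>) \<le> B'" using Cc_configs_bounded[OF H] by blast
  have B0: "0 \<le> B" "0 \<le> B'"
    using order_trans[OF norm_ge_zero B] order_trans[OF norm_ge_zero B'] by auto
  have supp: "size \<eta> \<le> N + N' \<and> set_mset \<eta> \<subseteq> \<Lambda> \<union> \<Lambda>'" if nz: "(G \<star> H) \<eta> \<noteq> 0" for \<eta>
  proof -
    obtain x where x: "config x {..<size \<eta>} = \<eta>"
      using config_surj[of \<eta> UNIV] by auto
    have "(\<Sum>(I, J, L)\<in>ordered_splits (size \<eta>). G (config x (I \<union> J)) * H (config x (J \<union> L))) \<noteq> 0"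
      using nz star_config[of G H x "size \<eta>"] by (simp add: x)
    then obtain s where "s \<in> ordered_splits (size \<eta>)"
      "(case s of (I, J, L) \<Rightarrow> G (config x (I \<union> J)) * H (config x (J \<union> L))) \<noteq> 0"
      by (rule sum.not_neutral_contains_not_neutral)
    then obtain I J L where IJL: "(I, J, L) \<in> ordered_splits (size \<eta>)"
      and nG: "G (config x (I \<union> J)) \<noteq> 0" and nH: "H (config x (J \<union> L)) \<noteq> 0"
      by (cases s) auto
    have un: "(I \<union> J) \<union> (J \<union> L) = {..<size \<eta>}"
      using IJL by (auto simp: ordered_splits_def)
    then have fin: "finite (I \<union> J)" "finite (J \<union> L)"
      using finite_subset[of "I \<union> J" "{..<size \<eta>}"] finite_subset[of "J \<union> L" "{..<size \<eta>}"] by auto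
    have "size \<eta> = card ((I \<union> J) \<union> (J \<union> L))"
      by (simp add: un)
    also have "\<dots> \<le> card (I \<union> J) + card (J \<union> L)"
      by (rule card_Un_le)
    also have "\<dots> \<le> N + N'"
      using suppG[OF nG] suppH[OF nH] by simp
    finally have "size \<eta> \<le> N + N'" .
    moreover have "set_mset \<eta> = x ` {..<size \<eta>}"
      using x set_mset_config[of "{..<size \<eta>}" x] by simp
    then have eq: "set_mset \<eta> = x ` (I \<union> J) \<union> x ` (J \<union> L)"
      by (simp only: un[symmetric] image_Un)
    have "x ` (I \<union> J) \<subseteq> \<Lambda>" "x ` (J \<union> L) \<subseteq> \<Lambda>'"
      using suppG[OF nG] suppH[OF nH] set_mset_config[OF fin(1), of x] set_mset_config[OF fin(2), of x]
      by simp_all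
    then have "set_mset \<eta> \<subseteq> \<Lambda> \<union> \<Lambda>'"
      unfolding eq by (rule Un_mono)
    ultimately show ?thesis ..
  qed
  have bound: "cmod ((G \<star> H) \<eta>) \<le> 8 ^ (N + N') * (B * B')" for \<eta>
  proof (cases "(G \<star> H) \<eta> = 0")
    case False
    obtain x where x: "config x {..<size \<eta>} = \<eta>"
      using config_surj[of \<eta> UNIV] by auto
    have "(G \<star> H) \<eta> = (\<Sum>(I, J, L)\<in>ordered_splits (size \<eta>). G (config x (I \<union> J)) * H (config x (J \<union> L)))"
      using star_config[of G H x "size \<eta>"] by (simp add: x)
    also have "cmod \<dots> \<le> real (card (ordered_splits (size \<eta>))) * (B * B')"
      using B B' B0 by (intro sum_norm_bound) (auto simp: norm_mult intro!: mult_mono)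
    also have "\<dots> \<le> 8 ^ (N + N') * (B * B')"
    proof (intro mult_right_mono)
      have "card (ordered_splits (size \<eta>)) \<le> 8 ^ size \<eta>"
        by (rule card_ordered_splits_le)
      also have "\<dots> \<le> 8 ^ (N + N')"
        using supp[OF False] by (intro power_increasing) auto
      finally show "real (card (ordered_splits (size \<eta>))) \<le> 8 ^ (N + N')"
        using of_nat_mono[where 'a = real] by fastforce
    qed (use B0 in auto)
    finally show ?thesis .
  qed (use B0 in auto)
  show thesis
    using compactin_Un[OF \<Lambda> \<Lambda>'] bound supp by (rule that)
qed

section \<open>Borel sets of configurations and integrability of convolutions\<close>

lemma space_simple_config_borel: "space (simple_config_borel X) = simple_configs X"
  and open_in_simple_config_borel:
    "config_open X W \<Longrightarrow> W \<inter> simple_configs X \<in> sets (simple_config_borel X)"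
proof -
  have *: "{W. openin (subtopology (config_topology X) (simple_configs X)) W} \<subseteq> Pow (simple_configs X)"
    using openin_subset by force
  then show "space (simple_config_borel X) = simple_configs X"
    by (simp add: simple_config_borel_def space_measure_of)
  show "W \<inter> simple_configs X \<in> sets (simple_config_borel X)" if "config_open X W"
    unfolding simple_config_borel_def sets_measure_of[OF *]
    by (rule sigma_sets.Basic) (use that in \<open>auto simp: openin_subtopology openin_config_topology\<close>)
qed

lemma borel_measurable_simple_config:
  fixes f :: "'p multiset \<Rightarrow> complex"
  assumes "continuous_map (config_topology X) euclidean f"
  shows "f \<in> borel_measurable (simple_config_borel X)"
proof (rule borel_measurableI)
  fix S :: "complex set" assume "open S"
  then have "config_open X {\<eta> \<in> topspace (config_topology X). f \<eta> \<in> S}"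
    using openin_continuous_map_preimage[OF assms] by (simp add: openin_config_topology)
  moreover have "f -` S \<inter> space (simple_config_borel X) =
      {\<eta> \<in> topspace (config_topology X). f \<eta> \<in> S} \<inter> simple_configs X"
    by (auto simp: space_simple_config_borel topspace_config_topology simple_configs_def)
  ultimately show "f -` S \<inter> space (simple_config_borel X) \<in> sets (simple_config_borel X)"
    by (simp only: open_in_simple_config_borel)
qed

text \<open>A difference of two open conditions: prescribing the number of points is open, and so is
  having a point in the open complement of \<open>\<Lambda>\<close>.\<close>

lemma n_point_configs_measurable:
  assumes "closedin (mtop X) \<Lambda>"
  shows "n_point_configs X \<Lambda> n \<in> sets (simple_config_borel X)"
proof -
  let ?T = "\<lambda>m. topspace (mtop (power_manifold X m))"
  let ?A = "{\<eta>. set_mset \<eta> \<subseteq> topspace (mtop X) \<and> size \<eta> = n}"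
  let ?B = "{\<eta>. set_mset \<eta> \<subseteq> topspace (mtop X) \<and> \<not> set_mset \<eta> \<subseteq> \<Lambda>}"
  have "openin (mtop (power_manifold X m)) {x \<in> ?T m. config x {..<m} \<in> ?A}" for m
  proof -
    \<comment> \<open>\<open>config x {..<m}\<close> always has size \<open>m\<close>, so the
      preimage is everything or nothing.\<close>
    have "{x \<in> ?T m. config x {..<m} \<in> ?A} = (if m = n then ?T m else {})"
      using config_in_topspace[of _ m "topspace (mtop X)" "{..<m}"] by auto
    then show ?thesis by (simp del: mtop_power_manifold topspace_product_topology)
  qed
  then have A: "config_open X ?A"
    unfolding config_open_def by auto
  have "openin (mtop (power_manifold X m)) {x \<in> ?T m. config x {..<m} \<in> ?B}" for m
  proof -
    have "{x \<in> ?T m. config x {..<m} \<in> ?B} = (\<Union>i\<in>{..<m}. {x \<in> ?T m. x i \<in> topspace (mtop X) - \<Lambda>})"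
      using config_in_topspace[of _ m "topspace (mtop X)" "{..<m}"] by (auto simp: set_mset_config)
    moreover have "openin (mtop (power_manifold X m)) {x \<in> ?T m. x i \<in> topspace (mtop X) - \<Lambda>}" if "i < m" for i
      using assms that by (intro openin_continuous_map_preimage[where Y = "mtop X"])
        (auto intro!: continuous_map_product_projection)
    ultimately show ?thesis by (auto intro: openin_Union)
  qed
  then have B: "config_open X ?B"
    unfolding config_open_def by auto
  have "n_point_configs X \<Lambda> n = ?A \<inter> simple_configs X - ?B \<inter> simple_configs X"
    by (auto simp: n_point_configs_def simple_configs_def)
  then show ?thesis
    using open_in_simple_config_borel[OF A] open_in_simple_config_borel[OF B] by (simp add: sets.Diff)
qed

text \<open>A bounded measurable function that vanishes off a set of finite measure is integrable.
  The set consists of finitely many layers of configurations in one compact set, each of finite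
  measure by condition (2). The Hausdorff property makes the compact set closed and thereby the
  layers measurable.\<close>

lemma star_integrable:
  assumes haus: "Hausdorff_space (mtop X)"
    and sets: "sets \<rho> = sets (simple_config_borel X)"
    and bound: "\<And>\<Lambda>. compactin (mtop X) \<Lambda> \<Longrightarrow>
           \<exists>C>0. \<forall>n. emeasure \<rho> (n_point_configs X \<Lambda> n) \<le> ennreal (C ^ n)"
    and G: "G \<in> Cc_configs X" and H: "H \<in> Cc_configs X"
  shows "integrable \<rho> (G \<star> H)"
proof -
  obtain N \<Lambda> B where \<Lambda>: "compactin (mtop X) \<Lambda>" and B: "\<And>\<eta>. cmod ((G \<star> H) \<eta>) \<le> B"
    and supp: "\<And>\<eta>. (G \<star> H) \<eta> \<noteq> 0 \<Longrightarrow> size \<eta> \<le> N \<and> set_mset \<eta> \<subseteq> \<Lambda>"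
    by (rule star_support_bound[OF G H], rule that)
  have n_point: "n_point_configs X \<Lambda> n \<in> sets \<rho>" for n
    unfolding sets using compactin_imp_closedin[OF haus \<Lambda>] by (rule n_point_configs_measurable)
  obtain C where C: "\<And>n. emeasure \<rho> (n_point_configs X \<Lambda> n) \<le> ennreal (C ^ n)"
    using bound[OF \<Lambda>] by blast
  define A where "A = (\<Union>n\<in>{..N}. n_point_configs X \<Lambda> n)"
  have space: "space \<rho> = simple_configs X"
    using sets_eq_imp_space_eq[OF sets] by (simp add: space_simple_config_borel)
  show ?thesis
  proof (rule integrableI_bounded_set)
    show "A \<in> sets \<rho>"
      unfolding A_def using n_point by auto
    show "G \<star> H \<in> borel_measurable \<rho>"
      unfolding measurable_cong_sets[OF sets refl]
      by (rule borel_measurable_simple_config[OF star_continuous[OF G H]])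
    have "emeasure \<rho> A \<le> (\<Sum>n\<in>{..N}. emeasure \<rho> (n_point_configs X \<Lambda> n))"
      unfolding A_def using n_point by (intro emeasure_subadditive_finite) auto
    also have "\<dots> \<le> (\<Sum>n\<in>{..N}. ennreal (C ^ n))"
      by (intro sum_mono C)
    also have "\<dots> < \<infinity>"
      by simp
    finally show "emeasure \<rho> A < \<infinity>" .
    show "AE \<eta>\<in>A in \<rho>. cmod ((G \<star> H) \<eta>) \<le> B"
      using B by simp
    show "AE \<eta> in \<rho>. \<eta> \<notin> A \<longrightarrow> (G \<star> H) \<eta> = 0"
      using supp by (intro AE_I2) (auto simp: A_def space n_point_configs_def)
  qed
qed


section \<open>Positive hermitian forms\<close>

text \<open>A semidefinite sesquilinear form: nonzero vectors of seminorm zero are allowed, because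
  classes are formed only among Cauchy sequences. What is used about the completion is proved here
  for sequences of representatives.\<close>

locale positive_form =
  fixes V :: "('b \<Rightarrow> complex) set" and B :: "('b \<Rightarrow> complex) \<Rightarrow> ('b \<Rightarrow> complex) \<Rightarrow> complex"
  assumes lincomb: "\<And>G H a b. G \<in> V \<Longrightarrow> H \<in> V \<Longrightarrow> (\<lambda>\<eta>. a * G \<eta> + b * H \<eta>) \<in> V"
    and lincomb_left: "\<And>G G' H a b. G \<in> V \<Longrightarrow> G' \<in> V \<Longrightarrow> H \<in> V \<Longrightarrow>
      B (\<lambda>\<eta>. a * G \<eta> + b * G' \<eta>) H = a * B G H + b * B G' H"
    and hermitian: "\<And>G H. G \<in> V \<Longrightarrow> H \<in> V \<Longrightarrow> B G H = cnj (B H G)"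
    and positive: "\<And>G. G \<in> V \<Longrightarrow> B G G \<in> \<real>\<^sub>\<ge>\<^sub>0"
begin

definition seminorm :: "('b \<Rightarrow> complex) \<Rightarrow> real" where
  "seminorm G = sqrt (Re (B G G))"

definition Cauchy_seq :: "(nat \<Rightarrow> 'b \<Rightarrow> complex) \<Rightarrow> bool" where
  "Cauchy_seq S \<longleftrightarrow> (\<forall>k. S k \<in> V) \<and>
     (\<forall>\<epsilon>>0. \<exists>N. \<forall>k\<ge>N. \<forall>l\<ge>N. seminorm (\<lambda>\<eta>. S k \<eta> - S l \<eta>) < \<epsilon>)"

lemma lincomb_right:
  assumes "G \<in> V" "G' \<in> V" "H \<in> V"
  shows "B H (\<lambda>\<eta>. a * G \<eta> + b * G' \<eta>) = cnj a * B H G + cnj b * B H G'"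
  using assms by (simp add: hermitian[of H] lincomb lincomb_left)

lemma diff_closed: "G \<in> V \<Longrightarrow> H \<in> V \<Longrightarrow> (\<lambda>\<eta>. G \<eta> - H \<eta>) \<in> V"
  using lincomb[of G H 1 "-1"] by simp

lemma diff_left: "G \<in> V \<Longrightarrow> G' \<in> V \<Longrightarrow> H \<in> V \<Longrightarrow> B (\<lambda>\<eta>. G \<eta> - G' \<eta>) H = B G H - B G' H"
  using lincomb_left[of G G' H 1 "-1"] by simp

lemma diff_right: "G \<in> V \<Longrightarrow> G' \<in> V \<Longrightarrow> H \<in> V \<Longrightarrow> B H (\<lambda>\<eta>. G \<eta> - G' \<eta>) = B H G - B H G'"
  using lincomb_right[of G G' H 1 "-1"] by simp

lemma Re_form_nonneg: "G \<in> V \<Longrightarrow> 0 \<le> Re (B G G)"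
  using positive by (auto simp: complex_nonneg_Reals_iff)

lemma form_eq_of_real: "G \<in> V \<Longrightarrow> B G G = of_real (Re (B G G))"
  using positive by (simp add: complex_nonneg_Reals_iff complex_eq_iff)

lemma seminorm_nonneg: "G \<in> V \<Longrightarrow> 0 \<le> seminorm G"
  by (simp add: seminorm_def Re_form_nonneg)

lemma seminorm_power2: "G \<in> V \<Longrightarrow> (seminorm G)\<^sup>2 = Re (B G G)"
  by (simp add: seminorm_def Re_form_nonneg)

text \<open>The discriminant argument in a form that permits \<open>B H H = 0\<close>: positivity at
  \<open>G + z * H\<close> gives an inequality for every real \<open>t\<close>, and \<open>t\<close>
  is chosen afterwards by cases.\<close>

lemma Cauchy_Schwarz:
  assumes G: "G \<in> V" and H: "H \<in> V"
  shows "cmod (B G H) \<le> seminorm G * seminorm H"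
proof -
  define a c b where "a = Re (B G G)" and "c = Re (B H H)" and "b = cmod (B G H)"
  have a: "B G G = of_real a" and c: "B H H = of_real c"
    using form_eq_of_real G H by (auto simp: a_def c_def)
  have ac: "0 \<le> a" "0 \<le> c"
    using Re_form_nonneg G H by (auto simp: a_def c_def)
  have *: "0 \<le> a - 2 * t * b\<^sup>2 + t\<^sup>2 * b\<^sup>2 * c" for t :: real
  proof -
    \<comment> \<open>The phase of \<open>B G H\<close> is absorbed into \<open>z\<close>, which
      leaves a real polynomial in \<open>t\<close>.\<close>
    define z where "z = - (of_real t * B G H)"
    have "(\<lambda>\<eta>. 1 * G \<eta> + z * H \<eta>) \<in> V"
      using G H by (rule lincomb)
    then have "0 \<le> Re (B (\<lambda>\<eta>. 1 * G \<eta> + z * H \<eta>) (\<lambda>\<eta>. 1 * G \<eta> + z * H \<eta>))"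
      by (rule Re_form_nonneg)
    also have "B (\<lambda>\<eta>. 1 * G \<eta> + z * H \<eta>) (\<lambda>\<eta>. 1 * G \<eta> + z * H \<eta>)
        = of_real a + cnj z * B G H + z * cnj (B G H) + z * cnj z * of_real c"
      using lincomb_left[OF G H lincomb[OF G H], of 1 z 1 z] lincomb_right[OF G H G, of 1 z]
        lincomb_right[OF G H H, of 1 z] hermitian[OF H G] a c
      by (simp add: algebra_simps)
    also have "cnj z * B G H = - of_real (t * b\<^sup>2)"
      using complex_norm_square[of "B G H"] by (simp add: z_def b_def mult.commute mult.left_commute)
    also have "z * cnj (B G H) = - of_real (t * b\<^sup>2)"
      using complex_norm_square[of "B G H"] by (simp add: z_def b_def mult.assoc)
    also have "z * cnj z = of_real (t\<^sup>2 * b\<^sup>2)"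
      using complex_norm_square[of z] by (simp add: z_def b_def norm_mult power_mult_distrib)
    finally show ?thesis
      by (simp add: algebra_simps)
  qed
  have "b\<^sup>2 \<le> a * c"
  proof (cases "c = 0")
    case True
    have "b\<^sup>2 \<le> 0"
    proof (rule ccontr)
      assume "\<not> b\<^sup>2 \<le> 0"
      \<comment> \<open>For \<open>c = 0\<close> the polynomial is affine in \<open>t\<close>, and
        this choice gives it the value -1.\<close>
      then show False
        using *[of "(a + 1) / (2 * b\<^sup>2)"] True by simp
    qed
    then show ?thesis using True by simp
  next
    case False
    then have "c > 0" using ac by simp
    \<comment> \<open>For \<open>c > 0\<close> and \<open>b\<close> nonzero the minimum is attained
      at \<open>t = 1 / c\<close>.\<close>
    have "0 \<le> a - 2 * (1 / c) * b\<^sup>2 + (1 / c)\<^sup>2 * b\<^sup>2 * c"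
      by (rule *)
    also have "\<dots> = a - b\<^sup>2 / c"
      using \<open>c > 0\<close> by (simp add: power2_eq_square)
    finally show ?thesis
      using \<open>c > 0\<close> by (simp add: field_simps)
  qed
  then have "sqrt (b\<^sup>2) \<le> sqrt (a * c)"
    by (rule real_sqrt_le_mono)
  then show ?thesis
    by (simp add: b_def a_def c_def seminorm_def real_sqrt_mult)
qed

text \<open>The squared seminorm of the left-hand difference is split in the first slot of the form,
  and Cauchy-Schwarz bounds both terms. The common factor cancels unless it is 0, when the claim is
  mere nonnegativity.\<close>

lemma seminorm_triangle:
  assumes G: "G \<in> V" and H: "H \<in> V" and L: "L \<in> V"
  shows "seminorm (\<lambda>\<eta>. G \<eta> - L \<eta>) \<le> seminorm (\<lambda>\<eta>. G \<eta> - H \<eta>) + seminorm (\<lambda>\<eta>. H \<eta> - L \<eta>)"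
proof -
  let ?P = "\<lambda>\<eta>. G \<eta> - H \<eta>" and ?Q = "\<lambda>\<eta>. H \<eta> - L \<eta>" and ?D = "\<lambda>\<eta>. G \<eta> - L \<eta>"
  have V: "?P \<in> V" "?Q \<in> V" "?D \<in> V"
    using G H L by (auto intro: diff_closed)
  have D: "?D = (\<lambda>\<eta>. 1 * ?P \<eta> + 1 * ?Q \<eta>)"
    by auto
  have "(seminorm ?D)\<^sup>2 = Re (B ?D ?D)"
    using V by (simp add: seminorm_power2)
  also have "B ?D ?D = B ?P ?D + B ?Q ?D"
    by (subst (1) D, subst lincomb_left) (simp_all add: V)
  also have "Re \<dots> \<le> cmod (B ?P ?D) + cmod (B ?Q ?D)"
    using complex_Re_le_cmod[of "B ?P ?D"] complex_Re_le_cmod[of "B ?Q ?D"] by simp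
  also have "\<dots> \<le> seminorm ?P * seminorm ?D + seminorm ?Q * seminorm ?D"
    using V by (intro add_mono Cauchy_Schwarz)
  finally have "seminorm ?D * seminorm ?D \<le> (seminorm ?P + seminorm ?Q) * seminorm ?D"
    by (simp add: power2_eq_square algebra_simps)
  then show ?thesis
    using seminorm_nonneg[OF V(1)] seminorm_nonneg[OF V(2)] seminorm_nonneg[OF V(3)]
    by (cases "seminorm ?D = 0") (auto simp: mult_le_cancel_right)
qed

lemma seminorm_zero: "G \<in> V \<Longrightarrow> seminorm (\<lambda>_. 0) = 0"
  using lincomb_left[of G G "\<lambda>_. 0" 0 0] lincomb[of G G 0 0] by (simp add: seminorm_def)

lemma seminorm_minus_commute:
  assumes "G \<in> V" "H \<in> V"
  shows "seminorm (\<lambda>\<eta>. G \<eta> - H \<eta>) = seminorm (\<lambda>\<eta>. H \<eta> - G \<eta>)"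
  using assms by (simp add: seminorm_def diff_left diff_right diff_closed algebra_simps)

section \<open>Cauchy sequences for the seminorm\<close>

lemma Cauchy_seqD: "Cauchy_seq S \<Longrightarrow> S k \<in> V"
  by (simp add: Cauchy_seq_def)

lemma Cauchy_seqE:
  assumes "Cauchy_seq S" "\<epsilon> > 0"
  obtains N where "\<And>k l. k \<ge> N \<Longrightarrow> l \<ge> N \<Longrightarrow> seminorm (\<lambda>\<eta>. S k \<eta> - S l \<eta>) < \<epsilon>"
  using assms unfolding Cauchy_seq_def by blast

lemma Cauchy_seq_const: "G \<in> V \<Longrightarrow> Cauchy_seq (\<lambda>_. G)"
  by (simp add: Cauchy_seq_def seminorm_zero)

lemma Cauchy_seq_bounded:
  assumes S: "Cauchy_seq S"
  obtains C where "C > 0" "\<And>k. seminorm (S k) \<le> C"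
proof -
  have V: "S k \<in> V" for k using S by (rule Cauchy_seqD)
  obtain N where N: "\<And>k l. k \<ge> N \<Longrightarrow> l \<ge> N \<Longrightarrow> seminorm (\<lambda>\<eta>. S k \<eta> - S l \<eta>) < 1"
    by (rule Cauchy_seqE[OF S, of 1], simp, rule that)
  \<comment> \<open>The added 1 bounds the distance of later terms from \<open>S N\<close> and keeps
    \<open>C\<close> positive, so that it can serve as a denominator.\<close>
  define C where "C = (\<Sum>k\<le>N. seminorm (S k)) + 1"
  have sum: "seminorm (S k) \<le> (\<Sum>k\<le>N. seminorm (S k))" if "k \<le> N" for k
    using that V by (intro member_le_sum) (auto intro: seminorm_nonneg)
  have "seminorm (S k) \<le> C" for k
  proof (cases "k \<le> N")
    case True
    then show ?thesis using sum by (simp add: C_def add_increasing2)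
  next
    case False
    have z: "(\<lambda>_. 0) \<in> V"
      using lincomb[OF V V, of 0 k 0 k] by simp
    have "seminorm (S k) \<le> seminorm (\<lambda>\<eta>. S k \<eta> - S N \<eta>) + seminorm (S N)"
      using seminorm_triangle[OF V V z, of k N] by simp
    then show ?thesis
      using N[of k N] False sum[of N] by (simp add: C_def)
  qed
  moreover have "C > 0"
    using sum_nonneg[of "{..N}" "\<lambda>k. seminorm (S k)"] V seminorm_nonneg by (auto simp: C_def)
  ultimately show thesis using that by blast
qed

lemma form_diff_bound:
  assumes "G \<in> V" "G' \<in> V" "H \<in> V" "H' \<in> V"
  shows "cmod (B G H - B G' H') \<le>
    seminorm (\<lambda>\<eta>. G \<eta> - G' \<eta>) * seminorm H + seminorm G' * seminorm (\<lambda>\<eta>. H \<eta> - H' \<eta>)"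
proof -
  have "B G H - B G' H' = B (\<lambda>\<eta>. G \<eta> - G' \<eta>) H + B G' (\<lambda>\<eta>. H \<eta> - H' \<eta>)"
    using assms by (simp add: diff_left diff_right)
  also have "cmod \<dots> \<le> cmod (B (\<lambda>\<eta>. G \<eta> - G' \<eta>) H) + cmod (B G' (\<lambda>\<eta>. H \<eta> - H' \<eta>))"
    by (rule norm_triangle_ineq)
  also have "\<dots> \<le> seminorm (\<lambda>\<eta>. G \<eta> - G' \<eta>) * seminorm H + seminorm G' * seminorm (\<lambda>\<eta>. H \<eta> - H' \<eta>)"
    using assms by (intro add_mono Cauchy_Schwarz diff_closed)
  finally show ?thesis .
qed

lemma form_convergent:
  assumes S: "Cauchy_seq S" and T: "Cauchy_seq T"
  shows "convergent (\<lambda>k. B (S k) (T k))"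
proof -
  obtain C where C: "C > 0" "\<And>k. seminorm (S k) \<le> C" using Cauchy_seq_bounded[OF S] by blast
  obtain D where D: "D > 0" "\<And>k. seminorm (T k) \<le> D" using Cauchy_seq_bounded[OF T] by blast
  have V: "S k \<in> V" "T k \<in> V" for k using S T by (auto intro: Cauchy_seqD)
  have "Cauchy (\<lambda>k. B (S k) (T k))"
  proof (rule metric_CauchyI)
    fix e :: real assume e: "e > 0"
    \<comment> \<open>Each increment is multiplied by the bound on the other sequence, hence the
      crossed denominators.\<close>
    obtain N where N: "\<And>k l. k \<ge> N \<Longrightarrow> l \<ge> N \<Longrightarrow> seminorm (\<lambda>\<eta>. S k \<eta> - S l \<eta>) < e / (2 * D)"
      by (rule Cauchy_seqE[OF S, of "e / (2 * D)"], simp add: e D(1), rule that)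
    obtain N' where N': "\<And>k l. k \<ge> N' \<Longrightarrow> l \<ge> N' \<Longrightarrow> seminorm (\<lambda>\<eta>. T k \<eta> - T l \<eta>) < e / (2 * C)"
      by (rule Cauchy_seqE[OF T, of "e / (2 * C)"], simp add: e C(1), rule that)
    have "dist (B (S k) (T k)) (B (S l) (T l)) < e" if k: "k \<ge> max N N'" and l: "l \<ge> max N N'" for k l
    proof -
      have "cmod (B (S k) (T k) - B (S l) (T l)) \<le>
          seminorm (\<lambda>\<eta>. S k \<eta> - S l \<eta>) * seminorm (T k) + seminorm (S l) * seminorm (\<lambda>\<eta>. T k \<eta> - T l \<eta>)"
        by (intro form_diff_bound V)
      also have "\<dots> \<le> seminorm (\<lambda>\<eta>. S k \<eta> - S l \<eta>) * D + C * seminorm (\<lambda>\<eta>. T k \<eta> - T l \<eta>)"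
        using C D by (intro add_mono mult_left_mono mult_right_mono seminorm_nonneg diff_closed V)
      also have "\<dots> < e / (2 * D) * D + C * (e / (2 * C))"
        using N[of k l] N'[of k l] k l C D
        by (intro add_strict_mono mult_strict_right_mono mult_strict_left_mono) auto
      also have "\<dots> = e"
        using C D by simp
      finally show ?thesis by (simp add: dist_norm)
    qed
    then show "\<exists>M. \<forall>m\<ge>M. \<forall>n\<ge>M. dist (B (S m) (T m)) (B (S n) (T n)) < e"
      by blast
  qed
  then show ?thesis
    by (simp add: Cauchy_convergent_iff)
qed

text \<open>This makes the limit of the form independent of the representatives of two
  classes.\<close>

lemma form_diff_tendsto_zero:
  assumes S: "Cauchy_seq S" "Cauchy_seq S'" and T: "Cauchy_seq T" "Cauchy_seq T'"
    and SS': "(\<lambda>k. seminorm (\<lambda>\<eta>. S k \<eta> - S' k \<eta>)) \<longlonglongrightarrow> 0"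
    and TT': "(\<lambda>k. seminorm (\<lambda>\<eta>. T k \<eta> - T' k \<eta>)) \<longlonglongrightarrow> 0"
  shows "(\<lambda>k. B (S k) (T k) - B (S' k) (T' k)) \<longlonglongrightarrow> 0"
proof -
  obtain C where C: "C > 0" "\<And>k. seminorm (S' k) \<le> C" using Cauchy_seq_bounded[OF S(2)] by blast
  obtain D where D: "D > 0" "\<And>k. seminorm (T k) \<le> D" using Cauchy_seq_bounded[OF T(1)] by blast
  have V: "S k \<in> V" "S' k \<in> V" "T k \<in> V" "T' k \<in> V" for k
    using S T by (auto intro: Cauchy_seqD)
  have bound: "norm (B (S k) (T k) - B (S' k) (T' k)) \<le>
      seminorm (\<lambda>\<eta>. S k \<eta> - S' k \<eta>) * D + C * seminorm (\<lambda>\<eta>. T k \<eta> - T' k \<eta>)" for k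
  proof -
    have "norm (B (S k) (T k) - B (S' k) (T' k)) \<le>
        seminorm (\<lambda>\<eta>. S k \<eta> - S' k \<eta>) * seminorm (T k) + seminorm (S' k) * seminorm (\<lambda>\<eta>. T k \<eta> - T' k \<eta>)"
      by (intro form_diff_bound V)
    also have "\<dots> \<le> seminorm (\<lambda>\<eta>. S k \<eta> - S' k \<eta>) * D + C * seminorm (\<lambda>\<eta>. T k \<eta> - T' k \<eta>)"
      using C D by (intro add_mono mult_left_mono mult_right_mono seminorm_nonneg diff_closed V)
    finally show ?thesis .
  qed
  have lim: "(\<lambda>k. seminorm (\<lambda>\<eta>. S k \<eta> - S' k \<eta>) * D + C * seminorm (\<lambda>\<eta>. T k \<eta> - T' k \<eta>)) \<longlonglongrightarrow> 0"
    by (intro tendsto_add_zero tendsto_mult_left_zero tendsto_mult_right_zero SS' TT')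
  show ?thesis
    by (rule Lim_null_comparison[OF always_eventually[OF allI[OF bound]] lim])
qed

text \<open>Density of \<open>V\<close> in its completion, expressed by representatives: an element
  orthogonal to \<open>V\<close> is zero. The second argument \<open>S k\<close> is replaced by a
  fixed \<open>S M\<close>; the weak hypothesis controls the main part, the Cauchy property and
  boundedness control the error.\<close>

lemma weakly_null_Cauchy_seq:
  assumes S: "Cauchy_seq S" and weak: "\<And>G. G \<in> V \<Longrightarrow> (\<lambda>k. B (S k) G) \<longlonglongrightarrow> 0"
  shows "(\<lambda>k. B (S k) (S k)) \<longlonglongrightarrow> 0"
proof (rule LIMSEQ_I)
  fix e :: real assume e: "e > 0"
  obtain C where C: "C > 0" "\<And>k. seminorm (S k) \<le> C" using Cauchy_seq_bounded[OF S] by blast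
  have V: "S k \<in> V" for k using S by (rule Cauchy_seqD)
  obtain M where M: "\<And>k l. k \<ge> M \<Longrightarrow> l \<ge> M \<Longrightarrow> seminorm (\<lambda>\<eta>. S k \<eta> - S l \<eta>) < e / (2 * C)"
    by (rule Cauchy_seqE[OF S, of "e / (2 * C)"], simp add: e C(1), rule that)
  \<comment> \<open>\<open>M\<close> is already fixed, so \<open>S M\<close> is a single element of
    \<open>V\<close> to which \<open>weak\<close> applies.\<close>
  obtain N where N: "\<And>k. k \<ge> N \<Longrightarrow> cmod (B (S k) (S M)) < e / 2"
    using LIMSEQ_D[OF weak[OF V], of "e / 2" M] e by auto
  have "cmod (B (S k) (S k)) < e" if "k \<ge> max M N" for k
  proof -
    have "B (S k) (S k) = B (S k) (S M) + B (S k) (\<lambda>\<eta>. S k \<eta> - S M \<eta>)"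
      by (simp add: diff_right V)
    also have "cmod \<dots> \<le> cmod (B (S k) (S M)) + cmod (B (S k) (\<lambda>\<eta>. S k \<eta> - S M \<eta>))"
      by (rule norm_triangle_ineq)
    also have "cmod (B (S k) (\<lambda>\<eta>. S k \<eta> - S M \<eta>)) \<le> seminorm (S k) * seminorm (\<lambda>\<eta>. S k \<eta> - S M \<eta>)"
      by (intro Cauchy_Schwarz V diff_closed)
    also have "\<dots> \<le> C * (e / (2 * C))"
      using C M[of k M] that by (intro mult_mono seminorm_nonneg diff_closed V) auto
    also have "\<dots> = e / 2"
      using C by simp
    finally show ?thesis
      using N[of k] that by simp
  qed
  then show "\<exists>N. \<forall>k\<ge>N. norm (B (S k) (S k) - 0) < e"
    by (intro exI[of _ "max M N"]) simp
qed

end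


section \<open>The Hilbert space of a correlation measure\<close>

lemma iter_partial_const: "is \<noteq> [] \<Longrightarrow> iter_partial is (\<lambda>_. c) = (\<lambda>_. 0)"
proof (induction "is")
  case (Cons i js)
  then show ?case
    by (cases "js = []") (auto simp: partial_deriv_def fun_eq_iff)
qed simp

lemma smooth_on_const: "smooth_on d W (\<lambda>_. c)"
proof -
  have "iter_partial js (\<lambda>_. c) = (\<lambda>_. if js = [] then c else 0)" for js
    by (cases "js = []") (auto simp: iter_partial_const)
  then show ?thesis
    by (simp add: smooth_on_def)
qed

lemma zero_test_function: "(\<lambda>_. 0) \<in> test_functions M"
  by (auto simp: test_functions_def smooth_on_const)

text \<open>This is the degree-zero component of the vacuum. The power of exponent 0 consists of the
  extensional point \<open>\<lambda>_. undefined\<close> and has dimension 0, so smoothness reduces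
  to continuity on a single point.\<close>

lemma indicator_test_function_power_0:
  "(\<lambda>x. if x = (\<lambda>_. undefined) then 1 else 0) \<in> test_functions (power_manifold M 0)"
    (is "?f \<in> _")
proof -
  have "mtop (power_manifold M 0) closure_of {p. ?f p \<noteq> 0} \<subseteq> {\<lambda>_. undefined}"
    using closure_of_subset_topspace[of "mtop (power_manifold M 0)" "{p. ?f p \<noteq> 0}"] by simp
  then have "finite (mtop (power_manifold M 0) closure_of {p. ?f p \<noteq> 0})"
    by (rule finite_subset) simp
  then have "compactin (mtop (power_manifold M 0)) (mtop (power_manifold M 0) closure_of {p. ?f p \<noteq> 0})"
    by (intro finite_imp_compactin closure_of_subset_topspace)
  moreover have "smooth_on 0 (c ` U) (\<lambda>u. ?f (inv_into U c u))"
    if "(U, c) \<in> charts (power_manifold M 0)" for U c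
  proof -
    have U: "U = {\<lambda>_. undefined}"
      using that by (auto simp: power_manifold_def)
    \<comment> \<open>Off the chart image \<open>inv_into\<close> is uncontrolled, so the comparison
      with the constant 1 is made on the subtopology.\<close>
    have "continuous_map (subtopology (Euclidean_space 0) (c ` U)) euclideanreal (\<lambda>u. ?f (inv_into U c u))"
      by (rule continuous_map_eq[where f = "\<lambda>_. 1"]) (auto simp: U inv_into_def)
    then show ?thesis
      by (simp add: smooth_on_def)
  qed
  ultimately show ?thesis
    by (auto simp: test_functions_def)
qed

text \<open>Test functions are real, so a complex combination is resolved into real ones: the real
  part of \<open>a * G\<close> has coefficients \<open>Re a\<close> and \<open>- Im a\<close> at the
  real and imaginary parts of \<open>G\<close>, and similarly for the imaginary part.\<close>

lemma F_fin_lincomb: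
  assumes X: "smooth_manifold X" and G: "G \<in> F_fin X" and H: "H \<in> F_fin X"
  shows "(\<lambda>\<eta>. a * G \<eta> + b * H \<eta>) \<in> F_fin X"
proof -
  let ?L = "\<lambda>\<eta>. a * G \<eta> + b * H \<eta>"
  obtain N N' where N: "\<And>\<eta>. size \<eta> > N \<Longrightarrow> G \<eta> = 0" "\<And>\<eta>. size \<eta> > N' \<Longrightarrow> H \<eta> = 0"
    using G H unfolding F_fin_def by blast
  have comp: "component X ?L n x = a * component X G n x + b * component X H n x" for n x
    by (simp add: component_def)
  have test: "(\<lambda>x. Re (component X F n x)) \<in> test_functions (power_manifold X n)"
    "(\<lambda>x. Im (component X F n x)) \<in> test_functions (power_manifold X n)" if "F \<in> F_fin X" for F n
    using that unfolding F_fin_def by blast+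
  note lin = test_functions_power_lincomb[OF X]
  have Re: "(\<lambda>x. Re (component X ?L n x)) \<in> test_functions (power_manifold X n)" for n
    using lin[OF lin[OF test(1)[OF G] test(2)[OF G], of "Re a" n "- Im a"]
        lin[OF test(1)[OF H] test(2)[OF H], of "Re b" n "- Im b"], of 1 1]
    by (simp add: comp)
  have Im: "(\<lambda>x. Im (component X ?L n x)) \<in> test_functions (power_manifold X n)" for n
    using lin[OF lin[OF test(2)[OF G] test(1)[OF G], of "Re a" n "Im a"]
        lin[OF test(2)[OF H] test(1)[OF H], of "Re b" n "Im b"], of 1 1]
    by (simp add: comp)
  have "\<forall>\<eta>. size \<eta> > max N N' \<longrightarrow> ?L \<eta> = 0"
    using N by simp
  moreover have "\<forall>\<eta>. \<not> set_mset \<eta> \<subseteq> topspace (mtop X) \<longrightarrow> ?L \<eta> = 0"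
    using G H by (simp add: F_fin_def)
  ultimately show ?thesis
    using Re Im unfolding F_fin_def by blast
qed

abbreviation vacuum :: "'p multiset \<Rightarrow> complex" where
  "vacuum \<equiv> \<lambda>\<eta>. if \<eta> = {#} then 1 else 0"

lemma component_vacuum:
  fixes X :: "'p manifold"
  shows "component X vacuum n = (\<lambda>x. if n = 0 \<and> x = (\<lambda>_. undefined) then 1 else 0)"
proof
  fix x :: "nat \<Rightarrow> 'p"
  have "config x {..<n} = {#} \<longleftrightarrow> n = 0"
    by (metis card_lessThan size_config size_eq_0_iff_empty)
  then show "component X vacuum n x = (if n = 0 \<and> x = (\<lambda>_. undefined) then 1 else 0)"
    by (auto simp: component_def)
qed

lemma vacuum_F_fin: "vacuum \<in> F_fin X"
proof -
  have "(\<lambda>x. Re (component X vacuum n x)) \<in> test_functions (power_manifold X n)" for n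
    using indicator_test_function_power_0[of X] zero_test_function
    by (cases "n = 0") (auto simp: component_vacuum if_distrib[of Re] cong: if_cong)
  moreover have "(\<lambda>x. Im (component X vacuum n x)) \<in> test_functions (power_manifold X n)" for n
    using zero_test_function by (simp add: component_vacuum if_distrib[of Im] cong: if_cong)
  moreover have "\<forall>\<eta> :: 'a multiset. size \<eta> > 0 \<longrightarrow> vacuum \<eta> = 0"
    by auto
  ultimately show ?thesis
    unfolding F_fin_def by auto
qed

lemma conj_fun_vacuum: "conj_fun vacuum = vacuum"
  by (auto simp: conj_fun_def fun_eq_iff)

lemma H_class_in_H_space: "S \<in> cauchy_seqs X \<rho> \<Longrightarrow> H_class X \<rho> S \<in> H_space X \<rho>"
  by (simp add: H_class_def H_space_def quotientI)

text \<open>\<open>rho_bound\<close> is condition (2) and \<open>rho_positive\<close> condition (3),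
  the latter as membership in the nonnegative reals. On the manifold they make
  \<open>rho_form\<close> an instance of \<open>positive_form\<close>.\<close>

locale correlation_measure =
  fixes X :: "'p manifold" and \<rho> :: "'p multiset measure"
  assumes manifold: "smooth_manifold X"
    and sets_rho: "sets \<rho> = sets (simple_config_borel X)"
    and rho_bound: "\<And>\<Lambda>. compactin (mtop X) \<Lambda> \<Longrightarrow>
           \<exists>C>0. \<forall>n. emeasure \<rho> (n_point_configs X \<Lambda> n) \<le> ennreal (C ^ n)"
    and rho_positive: "\<And>G. G \<in> F_fin X \<Longrightarrow> (\<integral>\<eta>. (G \<star> conj_fun G) \<eta> \<partial>\<rho>) \<in> \<real>\<^sub>\<ge>\<^sub>0"
begin

lemma star_conj_integrable: "G \<in> F_fin X \<Longrightarrow> H \<in> F_fin X \<Longrightarrow> integrable \<rho> (G \<star> conj_fun H)"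
  using manifold unfolding smooth_manifold_def
  by (intro star_integrable[OF _ sets_rho rho_bound] conj_fun_Cc_configs F_fin_subset_Cc_configs[OF manifold]) auto

text \<open>Linearity in the first slot uses additivity of the integral, which is where
  integrability of the convolutions enters; hermitian symmetry comes from commutativity of the
  convolution.\<close>

sublocale positive_form "F_fin X" "\<lambda>G H. rho_form \<rho> G (conj_fun H)"
proof
  fix G G' H :: "'p multiset \<Rightarrow> complex" and a b :: complex
  assume "G \<in> F_fin X" "G' \<in> F_fin X" "H \<in> F_fin X"
  then have "integrable \<rho> (G \<star> conj_fun H)" "integrable \<rho> (G' \<star> conj_fun H)"
    by (auto intro: star_conj_integrable)
  then show "rho_form \<rho> (\<lambda>\<eta>. a * G \<eta> + b * G' \<eta>) (conj_fun H) =
      a * rho_form \<rho> G (conj_fun H) + b * rho_form \<rho> G' (conj_fun H)"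
    by (simp add: rho_form_def star_lincomb_left)
next
  fix G H :: "'p multiset \<Rightarrow> complex"
  assume "G \<in> F_fin X" "H \<in> F_fin X"
  have "G \<star> conj_fun H = (\<lambda>\<eta>. cnj ((H \<star> conj_fun G) \<eta>))"
    by (subst star_commute) (simp add: cnj_star fun_eq_iff)
  then show "rho_form \<rho> G (conj_fun H) = cnj (rho_form \<rho> H (conj_fun G))"
    by (simp add: rho_form_def)
next
  fix G assume "G \<in> F_fin X"
  then show "rho_form \<rho> G (conj_fun G) \<in> \<real>\<^sub>\<ge>\<^sub>0"
    by (simp add: rho_form_def rho_positive)
qed (rule F_fin_lincomb[OF manifold])

section \<open>Classes of Cauchy sequences and limits along their representatives\<close>

lemma seminorm_eq: "seminorm = rho_seminorm \<rho>"
  by (simp add: fun_eq_iff seminorm_def rho_seminorm_def)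

lemma cauchy_seqs_iff: "S \<in> cauchy_seqs X \<rho> \<longleftrightarrow> Cauchy_seq S"
  by (simp add: cauchy_seqs_def Cauchy_seq_def seminorm_eq)

lemma null_rel_iff: "(S, T) \<in> null_rel X \<rho> \<longleftrightarrow>
    Cauchy_seq S \<and> Cauchy_seq T \<and> (\<lambda>k. seminorm (\<lambda>\<eta>. S k \<eta> - T k \<eta>)) \<longlonglongrightarrow> 0"
  by (simp add: null_rel_def cauchy_seqs_iff seminorm_eq)

lemma equiv_null_rel: "equiv (cauchy_seqs X \<rho>) (null_rel X \<rho>)"
proof (rule equivI)
  show "null_rel X \<rho> \<subseteq> cauchy_seqs X \<rho> \<times> cauchy_seqs X \<rho>"
    by (auto simp: null_rel_iff cauchy_seqs_iff)
  show "refl_on (cauchy_seqs X \<rho>) (null_rel X \<rho>)"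
    by (auto simp: refl_on_def null_rel_iff cauchy_seqs_iff seminorm_zero[OF Cauchy_seqD])
  show "sym (null_rel X \<rho>)"
  proof (rule symI)
    fix S T assume "(S, T) \<in> null_rel X \<rho>"
    then show "(T, S) \<in> null_rel X \<rho>"
      using seminorm_minus_commute[OF Cauchy_seqD Cauchy_seqD, of S T] by (simp add: null_rel_iff)
  qed
  show "trans (null_rel X \<rho>)"
  proof (rule transI)
    fix S T R assume "(S, T) \<in> null_rel X \<rho>" "(T, R) \<in> null_rel X \<rho>"
    then have C: "Cauchy_seq S" "Cauchy_seq T" "Cauchy_seq R"
      and l1: "(\<lambda>k. seminorm (\<lambda>\<eta>. S k \<eta> - T k \<eta>)) \<longlonglongrightarrow> 0"
      and l2: "(\<lambda>k. seminorm (\<lambda>\<eta>. T k \<eta> - R k \<eta>)) \<longlonglongrightarrow> 0"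
      by (auto simp: null_rel_iff)
    note V = C[THEN Cauchy_seqD]
    have nonneg: "0 \<le> seminorm (\<lambda>\<eta>. S k \<eta> - R k \<eta>)" for k
      by (intro seminorm_nonneg diff_closed V)
    have le: "seminorm (\<lambda>\<eta>. S k \<eta> - R k \<eta>) \<le>
        seminorm (\<lambda>\<eta>. S k \<eta> - T k \<eta>) + seminorm (\<lambda>\<eta>. T k \<eta> - R k \<eta>)" for k
      by (rule seminorm_triangle[OF V])
    have "(\<lambda>k. seminorm (\<lambda>\<eta>. S k \<eta> - R k \<eta>)) \<longlonglongrightarrow> 0"
      by (rule real_tendsto_sandwich[OF always_eventually[OF allI[OF nonneg]]
            always_eventually[OF allI[OF le]] tendsto_const tendsto_add_zero[OF l1 l2]])
    then show "(S, R) \<in> null_rel X \<rho>"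
      using C by (simp add: null_rel_iff)
  qed
qed

lemma H_space_nonempty: "\<xi> \<in> H_space X \<rho> \<Longrightarrow> \<exists>S. S \<in> \<xi>"
  unfolding H_space_def using in_quotient_imp_non_empty[OF equiv_null_rel] by blast

lemma H_space_Cauchy: "\<xi> \<in> H_space X \<rho> \<Longrightarrow> S \<in> \<xi> \<Longrightarrow> Cauchy_seq S"
  unfolding H_space_def using in_quotient_imp_subset[OF equiv_null_rel] cauchy_seqs_iff by blast

lemma H_space_null:
  assumes "\<xi> \<in> H_space X \<rho>" "S \<in> \<xi>" "T \<in> \<xi>"
  shows "(\<lambda>k. seminorm (\<lambda>\<eta>. S k \<eta> - T k \<eta>)) \<longlonglongrightarrow> 0"
  using in_quotient_imp_in_rel[OF equiv_null_rel, of \<xi> S T] assms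
  by (simp add: H_space_def null_rel_iff)

lemma hat_in_H_space: "G \<in> F_fin X \<Longrightarrow> hat X \<rho> G \<in> H_space X \<rho>"
  by (simp add: hat_def H_class_in_H_space cauchy_seqs_iff Cauchy_seq_const)

lemma const_in_hat: "G \<in> F_fin X \<Longrightarrow> (\<lambda>_. G) \<in> hat X \<rho> G"
  unfolding hat_def H_class_def
  by (rule equiv_class_self[OF equiv_null_rel]) (simp add: cauchy_seqs_iff Cauchy_seq_const)

text \<open>Justifies the \<open>THE\<close> in \<open>H_inner\<close>: the form converges along one
  pair of representatives, every other pair has the same limit, and since both classes are inhabited
  the value is unique.\<close>

lemma H_inner_tendsto:
  assumes \<xi>: "\<xi> \<in> H_space X \<rho>" and \<zeta>: "\<zeta> \<in> H_space X \<rho>" and S: "S \<in> \<xi>" and T: "T \<in> \<zeta>"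
  shows "(\<lambda>k. rho_form \<rho> (S k) (conj_fun (T k))) \<longlonglongrightarrow> H_inner \<rho> \<xi> \<zeta>"
proof -
  obtain z where z: "(\<lambda>k. rho_form \<rho> (S k) (conj_fun (T k))) \<longlonglongrightarrow> z"
    using form_convergent[OF H_space_Cauchy[OF \<xi> S] H_space_Cauchy[OF \<zeta> T]] by (auto simp: convergent_def)
  have "(\<lambda>k. rho_form \<rho> (S' k) (conj_fun (T' k))) \<longlonglongrightarrow> z" if S': "S' \<in> \<xi>" and T': "T' \<in> \<zeta>" for S' T'
  proof -
    have "(\<lambda>k. rho_form \<rho> (S' k) (conj_fun (T' k)) - rho_form \<rho> (S k) (conj_fun (T k))) \<longlonglongrightarrow> 0"
      by (intro form_diff_tendsto_zero H_space_Cauchy[OF \<xi>] H_space_Cauchy[OF \<zeta>]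
          H_space_null[OF \<xi>] H_space_null[OF \<zeta>] S T S' T')
    from tendsto_add[OF this z] show ?thesis by simp
  qed
  then have "\<forall>S\<in>\<xi>. \<forall>T\<in>\<zeta>. (\<lambda>k. rho_form \<rho> (S k) (conj_fun (T k))) \<longlonglongrightarrow> z"
    by blast
  then have "H_inner \<rho> \<xi> \<zeta> = z"
    unfolding H_inner_def using S T LIMSEQ_unique by (intro the_equality) blast+
  then show ?thesis using z by simp
qed

lemma H_integral_eq_H_inner:
  assumes \<xi>: "\<xi> \<in> H_space X \<rho>"
  shows "H_integral \<rho> \<xi> = H_inner \<rho> \<xi> (hat X \<rho> vacuum)"
proof -
  have lim: "(\<lambda>k. \<integral>\<eta>. S k \<eta> \<partial>\<rho>) \<longlonglongrightarrow> H_inner \<rho> \<xi> (hat X \<rho> vacuum)" if "S \<in> \<xi>" for S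
    using H_inner_tendsto[OF \<xi> hat_in_H_space[OF vacuum_F_fin] that const_in_hat[OF vacuum_F_fin]]
    by (simp only: conj_fun_vacuum rho_form_def star_empty_indicator)
  \<comment> \<open>The description in \<open>H_integral\<close> quantifies over representatives;
    without one of them it would not single out a value.\<close>
  obtain S where "S \<in> \<xi>"
    using H_space_nonempty[OF \<xi>] by blast
  then show ?thesis
    unfolding H_integral_def using lim LIMSEQ_unique by (intro the_equality) blast+
qed

end


section \<open>The image of the vacuum\<close>

lemma wick_pairing_cong: "component X G n = component X H n \<Longrightarrow> wick_pairing X G n \<omega> = wick_pairing X H n \<omega>"
  by (simp add: wick_pairing_def)

text \<open>In degree 0 the Wick power is evaluation at a point. In higher degrees the vacuum and
  the zero sequence have the same component, hence the same value of \<open>wick\<close>, whatever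
  it is.\<close>

lemma wick_pairing_vacuum:
  "wick_pairing X vacuum n \<omega> = (if n = 0 then 1 else 0) + wick_pairing X (\<lambda>_. 0) n \<omega>"
proof (cases "n = 0")
  case True
  then show ?thesis
    by (simp add: wick_pairing_def component_vacuum component_def complex_eq_iff)
next
  case False
  then have "component X vacuum n = component X (\<lambda>_. 0) n"
    by (simp only: component_vacuum) (simp add: component_def fun_eq_iff)
  from wick_pairing_cong[OF this] show ?thesis
    using False by simp
qed

text \<open>Beyond its last degree \<open>G\<close> has the components of the zero sequence, so the
  two series differ in finitely many terms.\<close>

lemma summable_wick_pairing_iff:
  assumes "G \<in> F_fin X"
  shows "summable (\<lambda>n. wick_pairing X G n \<omega>) \<longleftrightarrow> summable (\<lambda>n. wick_pairing X (\<lambda>_. 0) n \<omega>)"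
proof -
  obtain N where N: "\<And>\<eta>. size \<eta> > N \<Longrightarrow> G \<eta> = 0"
    using assms unfolding F_fin_def by blast
  have "component X G n = component X (\<lambda>_. 0) n" if "n > N" for n
    using that by (simp add: component_def N fun_eq_iff)
  then have "wick_pairing X G n \<omega> = wick_pairing X (\<lambda>_. 0) n \<omega>" if "n > N" for n
    using that wick_pairing_cong by blast
  then show ?thesis
    by (intro summable_cong eventually_sequentiallyI[of "Suc N"]) simp
qed

text \<open>\<open>suminf\<close> is a definite description over the predicate \<open>sums\<close>.
  For a divergent series this predicate is constantly false, so all divergent series receive one and
  the same value.\<close>

lemma suminf_eq_if_not_summable: "\<not> summable f \<Longrightarrow> \<not> summable g \<Longrightarrow> suminf f = suminf g"
proof -
  assume "\<not> summable f" "\<not> summable g"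
  then have "(sums) f = (\<lambda>_. False)" "(sums) g = (\<lambda>_. False)"
    by (auto simp: summable_def fun_eq_iff)
  then show ?thesis
    by (simp add: suminf_def)
qed

text \<open>
  The Wick powers are defined by \<open>THE\<close>, so nothing is known about their values at the zero function
  pointwise. Linearity of \<open>K\<close> makes the series for \<open>K\<close> of the zero class vanish almost everywhere;
  where the series diverges, all the series share the junk value of \<open>suminf\<close>, which is then \<open>0\<close>.
\<close>

lemma K_vacuum_eq_1_or_K_eq_0:
  assumes K: "\<And>G. G \<in> F_fin X \<Longrightarrow> AE \<omega> in \<mu>. K (hat X \<rho> G) \<omega> = (\<Sum>n. wick_pairing X G n \<omega>)"
    and K0: "AE \<omega> in \<mu>. K (hat X \<rho> (\<lambda>_. 0)) \<omega> = 0"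
    and zero: "(\<lambda>_. 0) \<in> F_fin X" and G: "G \<in> F_fin X"
  shows "AE \<omega> in \<mu>. K (hat X \<rho> vacuum) \<omega> = 1 \<or> K (hat X \<rho> G) \<omega> = 0"
  using K[OF zero] K0 K[OF vacuum_F_fin] K[OF G]
proof eventually_elim
  fix \<omega>
  assume 0: "K (hat X \<rho> (\<lambda>_. 0)) \<omega> = (\<Sum>n. wick_pairing X (\<lambda>_. 0) n \<omega>)" "K (hat X \<rho> (\<lambda>_. 0)) \<omega> = 0"
    and vac: "K (hat X \<rho> vacuum) \<omega> = (\<Sum>n. wick_pairing X vacuum n \<omega>)"
    and KG: "K (hat X \<rho> G) \<omega> = (\<Sum>n. wick_pairing X G n \<omega>)"
  show "K (hat X \<rho> vacuum) \<omega> = 1 \<or> K (hat X \<rho> G) \<omega> = 0"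
  proof (cases "summable (\<lambda>n. wick_pairing X (\<lambda>_. 0) n \<omega>)")
    case True
    then have "(\<lambda>n. wick_pairing X (\<lambda>_. 0) n \<omega>) sums 0"
      using 0 by (simp add: sums_iff)
    from sums_add[OF sums_single[of 0 "\<lambda>_. 1"] this]
    have "(\<lambda>n. wick_pairing X vacuum n \<omega>) sums 1"
      by (simp add: wick_pairing_vacuum)
    then show ?thesis
      using vac by (simp add: sums_iff)
  next
    case False
    then have "(\<Sum>n. wick_pairing X G n \<omega>) = (\<Sum>n. wick_pairing X (\<lambda>_. 0) n \<omega>)"
      using summable_wick_pairing_iff[OF G, of \<omega>] by (intro suminf_eq_if_not_summable) simp_all
    then show ?thesis
      using 0 KG by simp
  qed
qed

lemma K_vacuum_eq_1:
  assumes X\<rho>: "correlation_measure X \<rho>" and spec: "is_spectral_measure X \<rho> \<mu> K"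
  shows "AE \<omega> in \<mu>. K (hat X \<rho> vacuum) \<omega> = 1"
proof -
  interpret correlation_measure X \<rho> by (rule X\<rho>)
  interpret prob_space \<mu> using spec by (simp add: is_spectral_measure_def)
  let ?\<Omega> = "hat X \<rho> vacuum"
  have K: "AE \<omega> in \<mu>. K (hat X \<rho> G) \<omega> = (\<Sum>n. wick_pairing X G n \<omega>)" if "G \<in> F_fin X" for G
    using spec that unfolding is_spectral_measure_def by blast
  have uni: "unitary_onto_L2 X \<rho> \<mu> K"
    using spec unfolding is_spectral_measure_def by blast
  have L2: "square_integrable \<mu> (K \<xi>)" if "\<xi> \<in> H_space X \<rho>" for \<xi>
    using uni that unfolding unitary_onto_L2_def by blast
  have inner: "(\<integral>\<omega>. K \<xi> \<omega> * cnj (K \<zeta> \<omega>) \<partial>\<mu>) = H_inner \<rho> \<xi> \<zeta>"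
    if "\<xi> \<in> H_space X \<rho>" "\<zeta> \<in> H_space X \<rho>" for \<xi> \<zeta>
    using uni that unfolding unitary_onto_L2_def by blast
  have zero: "(\<lambda>_. 0) \<in> F_fin X"
    using lincomb[OF vacuum_F_fin vacuum_F_fin, of 0 0] by simp
  have vac: "(\<lambda>_. vacuum) \<in> cauchy_seqs X \<rho>"
    by (simp add: cauchy_seqs_iff Cauchy_seq_const vacuum_F_fin)
  have "\<forall>S\<in>cauchy_seqs X \<rho>. \<forall>T\<in>cauchy_seqs X \<rho>. \<forall>a b. AE \<omega> in \<mu>.
      K (H_class X \<rho> (\<lambda>k \<eta>. a * S k \<eta> + b * T k \<eta>)) \<omega> =
        a * K (H_class X \<rho> S) \<omega> + b * K (H_class X \<rho> T) \<omega>"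
    using uni unfolding unitary_onto_L2_def by blast
  \<comment> \<open>With both coefficients 0 the combination is the zero sequence, whichever Cauchy
    sequences are inserted.\<close>
  from this[rule_format, OF vac vac, of 0 0]
  have K0: "AE \<omega> in \<mu>. K (hat X \<rho> (\<lambda>_. 0)) \<omega> = 0"
    by (simp add: hat_def)
  have \<Omega>: "?\<Omega> \<in> H_space X \<rho>"
    by (rule hat_in_H_space[OF vacuum_F_fin])
  have meas: "K ?\<Omega> \<in> borel_measurable \<mu>" and sq: "integrable \<mu> (\<lambda>\<omega>. (cmod (K ?\<Omega> \<omega>))\<^sup>2)"
    using L2[OF \<Omega>] by (auto simp: square_integrable_def)
  \<comment> \<open>Constants are integrable for a probability measure, so a constant plus a
    multiple of the squared modulus of \<open>K ?\<Omega>\<close> can dominate.\<close>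
  have "square_integrable \<mu> (\<lambda>\<omega>. 1 - K ?\<Omega> \<omega>)"
    unfolding square_integrable_def
  proof
    show "(\<lambda>\<omega>. 1 - K ?\<Omega> \<omega>) \<in> borel_measurable \<mu>"
      using meas by simp
    show "integrable \<mu> (\<lambda>\<omega>. (cmod (1 - K ?\<Omega> \<omega>))\<^sup>2)"
    proof (rule Bochner_Integration.integrable_bound)
      show "integrable \<mu> (\<lambda>\<omega>. 2 + 2 * (cmod (K ?\<Omega> \<omega>))\<^sup>2)"
        using sq by simp
      show "(\<lambda>\<omega>. (cmod (1 - K ?\<Omega> \<omega>))\<^sup>2) \<in> borel_measurable \<mu>"
        using meas by measurable
      have "(cmod (1 - z))\<^sup>2 \<le> 2 + 2 * (cmod z)\<^sup>2" for z
      proof -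
        have "(cmod (1 - z))\<^sup>2 \<le> (1 + cmod z)\<^sup>2"
          using norm_triangle_ineq4[of 1 z] by (intro power_mono) auto
        also have "\<dots> \<le> 2 + 2 * (cmod z)\<^sup>2"
          using sum_squares_bound[of 1 "cmod z"] by (simp add: power2_sum)
        finally show ?thesis .
      qed
      then show "AE \<omega> in \<mu>. norm ((cmod (1 - K ?\<Omega> \<omega>))\<^sup>2) \<le> norm (2 + 2 * (cmod (K ?\<Omega> \<omega>))\<^sup>2)"
        by simp
    qed
  qed
  \<comment> \<open>Surjectivity of \<open>K\<close> brings the defect
    \<open>1 - K ?\<Omega>\<close> into the Hilbert space, where it has Cauchy
    representatives.\<close>
  then obtain \<xi> where \<xi>: "\<xi> \<in> H_space X \<rho>" and K\<xi>: "AE \<omega> in \<mu>. K \<xi> \<omega> = 1 - K ?\<Omega> \<omega>"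
    using uni unfolding unitary_onto_L2_def by blast
  have orth: "H_inner \<rho> \<xi> (hat X \<rho> G) = 0" if G: "G \<in> F_fin X" for G
  proof -
    have "AE \<omega> in \<mu>. K ?\<Omega> \<omega> = 1 \<or> K (hat X \<rho> G) \<omega> = 0"
      by (rule K_vacuum_eq_1_or_K_eq_0[OF K K0 zero G])
    then have "AE \<omega> in \<mu>. K \<xi> \<omega> * cnj (K (hat X \<rho> G) \<omega>) = 0"
      using K\<xi> by eventually_elim auto
    then have "(\<integral>\<omega>. K \<xi> \<omega> * cnj (K (hat X \<rho> G) \<omega>) \<partial>\<mu>) = 0"
      by (rule integral_eq_zero_AE)
    then show ?thesis
      using inner[OF \<xi> hat_in_H_space[OF G]] by simp
  qed
  obtain S where S: "S \<in> \<xi>"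
    using H_space_nonempty[OF \<xi>] by blast
  \<comment> \<open>Orthogonality to every finite sequence says that the representative
    \<open>S\<close> is weakly null.\<close>
  have "(\<lambda>k. rho_form \<rho> (S k) (conj_fun G)) \<longlonglongrightarrow> 0" if "G \<in> F_fin X" for G
    using H_inner_tendsto[OF \<xi> hat_in_H_space[OF that] S const_in_hat[OF that]] orth[OF that] by simp
  then have "(\<lambda>k. rho_form \<rho> (S k) (conj_fun (S k))) \<longlonglongrightarrow> 0"
    by (rule weakly_null_Cauchy_seq[OF H_space_Cauchy[OF \<xi> S]])
  then have "H_inner \<rho> \<xi> \<xi> = 0"
    using H_inner_tendsto[OF \<xi> \<xi> S S] LIMSEQ_unique by blast
  \<comment> \<open>Unitarity turns the vanishing norm of \<open>\<xi>\<close> into a vanishing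
    integral of a nonnegative function.\<close>
  then have "(\<integral>\<omega>. complex_of_real ((cmod (K \<xi> \<omega>))\<^sup>2) \<partial>\<mu>) = 0"
    using inner[OF \<xi> \<xi>] by (simp only: complex_norm_square)
  then have "(\<integral>\<omega>. (cmod (K \<xi> \<omega>))\<^sup>2 \<partial>\<mu>) = 0"
    by (simp only: integral_complex_of_real of_real_eq_0_iff)
  moreover have "integrable \<mu> (\<lambda>\<omega>. (cmod (K \<xi> \<omega>))\<^sup>2)"
    using L2[OF \<xi>] by (simp add: square_integrable_def)
  ultimately have "AE \<omega> in \<mu>. (cmod (K \<xi> \<omega>))\<^sup>2 = 0"
    by (subst (asm) integral_nonneg_eq_0_iff_AE) auto
  then show ?thesis
    using K\<xi> by eventually_elim simp
qed

theorem corollary1: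
  fixes X :: "'a manifold"
    and g :: "'a chart \<Rightarrow> 'a \<Rightarrow> real mat"
    and \<rho> :: "'a multiset measure"
    and \<mu> :: "(('a \<Rightarrow> real) \<Rightarrow> real) measure"
    and K :: "(nat \<Rightarrow> 'a multiset \<Rightarrow> complex) set \<Rightarrow> (('a \<Rightarrow> real) \<Rightarrow> real) \<Rightarrow> complex"
  assumes "smooth_manifold X"
    and "connected_space (mtop X)"
    and "\<not> compact_space (mtop X)"
    and "oriented X"
    and "riemannian_metric X g"
    and "sets \<rho> = sets (simple_config_borel X)"
    and "emeasure \<rho> {{#}} = 1"
    and "\<And>\<Lambda>. compactin (mtop X) \<Lambda> \<Longrightarrow>
           \<exists>C>0. \<forall>n. emeasure \<rho> (n_point_configs X \<Lambda> n) \<le> ennreal (C ^ n)"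
    and "\<And>G. G \<in> F_fin X \<Longrightarrow> (\<integral>\<eta>. (G \<star> conj_fun G) \<eta> \<partial>\<rho>) \<in> \<real>\<^sub>\<ge>\<^sub>0"
    and "is_spectral_measure X \<rho> \<mu> K"
  shows "\<forall>\<xi>\<in>H_space X \<rho>. H_integral \<rho> \<xi> = (\<integral>\<omega>. K \<xi> \<omega> \<partial>\<mu>)"
proof
  fix \<xi> assume \<xi>: "\<xi> \<in> H_space X \<rho>"
  interpret correlation_measure X \<rho>
    using assms by unfold_locales auto
  have uni: "unitary_onto_L2 X \<rho> \<mu> K"
    using assms(10) unfolding is_spectral_measure_def by blast
  have \<Omega>: "hat X \<rho> vacuum \<in> H_space X \<rho>"
    by (rule hat_in_H_space[OF vacuum_F_fin])
  have meas: "K \<xi> \<in> borel_measurable \<mu>" "K (hat X \<rho> vacuum) \<in> borel_measurable \<mu>"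
    using uni \<xi> \<Omega> unfolding unitary_onto_L2_def square_integrable_def by blast+
  \<comment> \<open>\<open>integral_cong_AE\<close> requires measurability of both
    integrands.\<close>
  have cnj_meas: "(\<lambda>\<omega>. cnj (K (hat X \<rho> vacuum) \<omega>)) \<in> borel_measurable \<mu>"
    using meas(2) by (rule measurable_compose)
      (intro borel_measurable_continuous_onI continuous_intros)
  have "AE \<omega> in \<mu>. K (hat X \<rho> vacuum) \<omega> = 1"
    by (rule K_vacuum_eq_1[OF correlation_measure_axioms assms(10)])
  \<comment> \<open>The inserted factor 1 is written as a conjugate, because the vacuum occupies the
    second slot of the scalar product.\<close>
  then have "AE \<omega> in \<mu>. K \<xi> \<omega> = K \<xi> \<omega> * cnj (K (hat X \<rho> vacuum) \<omega>)"
    by eventually_elim simp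
  then have "(\<integral>\<omega>. K \<xi> \<omega> \<partial>\<mu>) = (\<integral>\<omega>. K \<xi> \<omega> * cnj (K (hat X \<rho> vacuum) \<omega>) \<partial>\<mu>)"
    by (intro integral_cong_AE borel_measurable_times cnj_meas meas)
  also have "\<dots> = H_inner \<rho> \<xi> (hat X \<rho> vacuum)"
    using uni \<xi> \<Omega> unfolding unitary_onto_L2_def by blast
  finally show "H_integral \<rho> \<xi> = (\<integral>\<omega>. K \<xi> \<omega> \<partial>\<mu>)"
    using H_integral_eq_H_inner[OF \<xi>] by simp
qed

end
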